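(* Let $(I,\preceq)$ be a finite poset, $\mathcal A$ an abelian category, and $X\in\mathcal A$. Suppose that for each s-set $J\subseteq I$ we are given a subobject $S^J\subset X$, such that $$S^\emptyset=0,\quad S^I=X,\quad S^A\cap S^B=S^{A\cap B}\quad\text{and}\quad S^A+S^B=S^{A\cup B}$$ for all s-sets $A,B\subseteq I$. Then there exists an $(I,\preceq)$-configuration $(\sigma,\iota,\pi)$ in $\mathcal A$ with $\sigma(I)=X$ such that $\iota(J,I):\sigma(J)\to X$ represents $S^J\subset X$ for each s-set $J\subseteq I$. This $(\sigma,\iota,\pi)$ is unique up to canonical isomorphism in $\mathcal A$.
   Context: Let $(I,\preceq)$ be a finite poset. A subset $J\subseteq I$ is an s-set if $i\in I$, $j\in J$, $i\preceq j$ imply $i\in J$; it is an f-set if $i\in I$, $h,j\in J$, $h\preceq i\preceq j$ imply $i\in J$. $\mathcal F_{(I,\preceq)}$ is the set of f-sets of $I$; $\mathcal G_{(I,\preceq)}$ is the set of pairs $(J,K)$ of f-sets with $J\subseteq K$ such that $j\in J$, $k\in K$, $k\preceq j$ imply $k\in J$; $\mathcal H_{(I,\preceq)}$ is the set of pairs $(J,K)$ of f-sets with $K\subseteq J$ such that $j\in J$, $k\in K$, $k\preceq j$ imply $j\in K$. An $(I,\preceq)$-configuration $(\sigma,\iota,\pi)$ in $\mathcal A$ consists of objects $\sigma(J)$ for $J\in\mathcal F_{(I,\preceq)}$ with $\sigma(\emptyset)=0$; injective morphisms $\iota(J,K):\sigma(J)\to\sigma(K)$ for $(J,K)\in\mathcal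 G_{(I,\preceq)}$ with $\iota(J,J)=\mathrm{id}_{\sigma(J)}$; and surjective morphisms $\pi(J,K):\sigma(J)\to\sigma(K)$ for $(J,K)\in\mathcal H_{(I,\preceq)}$ with $\pi(J,J)=\mathrm{id}_{\sigma(J)}$, such that: (A) if $(J,K)\in\mathcal G_{(I,\preceq)}$ and $L=K\setminus J$ then $0\to\sigma(J)\xrightarrow{\iota(J,K)}\sigma(K)\xrightarrow{\pi(K,L)}\sigma(L)\to0$ is exact; (B) if $(J,K),(K,L)\in\mathcal G_{(I,\preceq)}$ then $\iota(J,L)=\iota(K,L)\circ\iota(J,K)$; (C) if $(J,K),(K,L)\in\mathcal H_{(I,\preceq)}$ then $\pi(J,L)=\pi(K,L)\circ\pi(J,K)$; (D) if $(J,K)\in\mathcal G_{(I,\preceq)}$ and $(K,L)\in\mathcal H_{(I,\preceq)}$ then $\pi(K,L)\circ\iota(J,K)=\iota(J\cap L,L)\circ\pi(J,J\cap L)$. A morphism $\alpha:(\sigma,\iota,\pi)\to(\sigma',\iota',\pi')$ is a collection of morphisms $\alpha(J):\sigma(J)\to\sigma'(J)$, $J\in\mathcal F_{(I,\preceq)}$, with $\alpha(K)\circ\iota(J,K)=\iota'(J,K)\circ\alpha(J)$ on $\mathcal G_{(I,\preceq)}$ and $\alpha(K)\circ\pi(J,K)=\pi'(J,K)\circ\alpha(J)$ on $\mathcal H_{(I,\preceq)}$; it is an isomorphism if all $\alpha(J)$ are. Subobjects of $X$ are equivalence classes of injective morphisms into $X$; $\cap$ and $+$ are the usual intersection and sum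 (join) of subobjects. "Unique up to canonical isomorphism" means: for any two such configurations there is a unique isomorphism $\alpha$ between them with $\alpha(I)=\mathrm{id}_X$. *)

theory Defs
  imports "HOL-Algebra.Group" "HOL-Library.FuncSet"
begin

section \<open>Abelian categories\<close>

record ('o, 'm) cat =
  Obj :: "'o set"
  Arr :: "'m set"
  Dom :: "'m \<Rightarrow> 'o"
  Cod :: "'m \<Rightarrow> 'o"
  Idt :: "'o \<Rightarrow> 'm"
  Comp :: "'m \<Rightarrow> 'm \<Rightarrow> 'm"  (infixl \<open>\<bullet>\<index>\<close> 70)

definition homs :: "('o, 'm, 'z) cat_scheme \<Rightarrow> 'o \<Rightarrow> 'o \<Rightarrow> 'm set" where
  "homs C X Y = {f \<in> Arr C. Dom C f = X \<and> Cod C f = Y}"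

locale category =
  fixes C :: "('o, 'm, 'z) cat_scheme" (structure)
  assumes Dom_Obj: "f \<in> Arr C \<Longrightarrow> Dom C f \<in> Obj C"
    and Cod_Obj: "f \<in> Arr C \<Longrightarrow> Cod C f \<in> Obj C"
    and Idt_homs: "X \<in> Obj C \<Longrightarrow> Idt C X \<in> homs C X X"
    and Comp_homs: "\<lbrakk>f \<in> homs C X Y; g \<in> homs C Y Z\<rbrakk> \<Longrightarrow> g \<bullet> f \<in> homs C X Z"
    and Comp_Idt: "f \<in> homs C X Y \<Longrightarrow> f \<bullet> Idt C X = f"
    and Idt_Comp: "f \<in> homs C X Y \<Longrightarrow> Idt C Y \<bullet> f = f"
    and Comp_assoc: "\<lbrakk>f \<in> homs C W X; g \<in> homs C X Y; h \<in> homs C Y Z\<rbrakk>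
      \<Longrightarrow> (h \<bullet> g) \<bullet> f = h \<bullet> (g \<bullet> f)"

definition mono_arr :: "('o, 'm, 'z) cat_scheme \<Rightarrow> 'm \<Rightarrow> bool" where
  "mono_arr C f \<longleftrightarrow> f \<in> Arr C \<and>
     (\<forall>W\<in>Obj C. \<forall>g\<in>homs C W (Dom C f). \<forall>h\<in>homs C W (Dom C f).
        f \<bullet>\<^bsub>C\<^esub> g = f \<bullet>\<^bsub>C\<^esub> h \<longrightarrow> g = h)"

definition epi_arr :: "('o, 'm, 'z) cat_scheme \<Rightarrow> 'm \<Rightarrow> bool" where
  "epi_arr C f \<longleftrightarrow> f \<in> Arr C \<and>
     (\<forall>W\<in>Obj C. \<forall>g\<in>homs C (Cod C f) W. \<forall>h\<in>homs C (Cod C f) W.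
        g \<bullet>\<^bsub>C\<^esub> f = h \<bullet>\<^bsub>C\<^esub> f \<longrightarrow> g = h)"

definition iso_arr :: "('o, 'm, 'z) cat_scheme \<Rightarrow> 'm \<Rightarrow> bool" where
  "iso_arr C f \<longleftrightarrow> f \<in> Arr C \<and>
     (\<exists>g\<in>homs C (Cod C f) (Dom C f).
        g \<bullet>\<^bsub>C\<^esub> f = Idt C (Dom C f) \<and> f \<bullet>\<^bsub>C\<^esub> g = Idt C (Cod C f))"

definition zero_object :: "('o, 'm, 'z) cat_scheme \<Rightarrow> 'o \<Rightarrow> bool" where
  "zero_object C Z \<longleftrightarrow> Z \<in> Obj C \<and>
     (\<forall>Y\<in>Obj C. (\<exists>!f. f \<in> homs C Z Y) \<and> (\<exists>!f. f \<in> homs C Y Z))"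

record ('o, 'm) additive_cat = "('o, 'm) cat" +
  Add :: "'m \<Rightarrow> 'm \<Rightarrow> 'm"  (infixl \<open>\<boxplus>\<index>\<close> 65)
  Zero :: "'o \<Rightarrow> 'o \<Rightarrow> 'm"

locale preadditive_category = category C
  for C :: "('o, 'm, 'z) additive_cat_scheme" (structure) +
  assumes homs_comm_group: "\<lbrakk>X \<in> Obj C; Y \<in> Obj C\<rbrakk>
      \<Longrightarrow> comm_group \<lparr>carrier = homs C X Y, monoid.mult = Add C, one = Zero C X Y\<rparr>"
    and Comp_Add: "\<lbrakk>f \<in> homs C X Y; f' \<in> homs C X Y; g \<in> homs C Y Z\<rbrakk>
      \<Longrightarrow> g \<bullet> (f \<boxplus> f') = (g \<bullet> f) \<boxplus> (g \<bullet> f')"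
    and Add_Comp: "\<lbrakk>f \<in> homs C X Y; g \<in> homs C Y Z; g' \<in> homs C Y Z\<rbrakk>
      \<Longrightarrow> (g \<boxplus> g') \<bullet> f = (g \<bullet> f) \<boxplus> (g' \<bullet> f)"

definition is_kernel :: "('o, 'm, 'z) additive_cat_scheme \<Rightarrow> 'm \<Rightarrow> 'm \<Rightarrow> bool" where
  "is_kernel C k f \<longleftrightarrow> f \<in> Arr C \<and> k \<in> Arr C \<and> Cod C k = Dom C f \<and>
     f \<bullet>\<^bsub>C\<^esub> k = Zero C (Dom C k) (Cod C f) \<and>
     (\<forall>W\<in>Obj C. \<forall>g\<in>homs C W (Dom C f). f \<bullet>\<^bsub>C\<^esub> g = Zero C W (Cod C f) \<longrightarrow>
        (\<exists>!h. h \<in> homs C W (Dom C k) \<and> k \<bullet>\<^bsub>C\<^esub> h = g))"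

definition is_cokernel :: "('o, 'm, 'z) additive_cat_scheme \<Rightarrow> 'm \<Rightarrow> 'm \<Rightarrow> bool" where
  "is_cokernel C c f \<longleftrightarrow> f \<in> Arr C \<and> c \<in> Arr C \<and> Dom C c = Cod C f \<and>
     c \<bullet>\<^bsub>C\<^esub> f = Zero C (Dom C f) (Cod C c) \<and>
     (\<forall>W\<in>Obj C. \<forall>g\<in>homs C (Cod C f) W. g \<bullet>\<^bsub>C\<^esub> f = Zero C (Dom C f) W \<longrightarrow>
        (\<exists>!h. h \<in> homs C (Cod C c) W \<and> h \<bullet>\<^bsub>C\<^esub> c = g))"

locale abelian_category = preadditive_category C
  for C :: "('o, 'm, 'z) additive_cat_scheme" (structure) +
  assumes ex_zero_object: "\<exists>Z. zero_object C Z"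
    and ex_biproduct: "\<lbrakk>X \<in> Obj C; Y \<in> Obj C\<rbrakk> \<Longrightarrow>
      \<exists>P\<in>Obj C. \<exists>i\<in>homs C X P. \<exists>j\<in>homs C Y P. \<exists>p\<in>homs C P X. \<exists>q\<in>homs C P Y.
        p \<bullet> i = Idt C X \<and> q \<bullet> j = Idt C Y \<and> q \<bullet> i = Zero C X Y \<and> p \<bullet> j = Zero C Y X \<and>
        (i \<bullet> p) \<boxplus> (j \<bullet> q) = Idt C P"
    and ex_kernel: "f \<in> Arr C \<Longrightarrow> \<exists>k. is_kernel C k f"
    and ex_cokernel: "f \<in> Arr C \<Longrightarrow> \<exists>c. is_cokernel C c f"
    and mono_normal: "mono_arr C f \<Longrightarrow> \<exists>g. is_kernel C f g"
    and epi_normal: "epi_arr C f \<Longrightarrow> \<exists>g. is_cokernel C f g"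

definition is_image :: "('o, 'm, 'z) additive_cat_scheme \<Rightarrow> 'm \<Rightarrow> 'm \<Rightarrow> bool" where
  "is_image C m f \<longleftrightarrow> (\<exists>c. is_cokernel C c f \<and> is_kernel C m c)"

definition exact_pair :: "('o, 'm, 'z) additive_cat_scheme \<Rightarrow> 'm \<Rightarrow> 'm \<Rightarrow> bool" where
  "exact_pair C f g \<longleftrightarrow> (\<exists>m. is_image C m f \<and> is_kernel C m g)"

definition short_exact :: "('o, 'm, 'z) additive_cat_scheme \<Rightarrow> 'm \<Rightarrow> 'm \<Rightarrow> bool" where
  "short_exact C f g \<longleftrightarrow> (\<exists>Z. zero_object C Z \<and>
     exact_pair C (Zero C Z (Dom C f)) f \<and> exact_pair C f g \<and>
     exact_pair C g (Zero C (Cod C g) Z))"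


section \<open>Subobjects\<close>

definition monos_into :: "('o, 'm, 'z) cat_scheme \<Rightarrow> 'o \<Rightarrow> 'm set" where
  "monos_into C X = {f. mono_arr C f \<and> Cod C f = X}"

definition subobj_equiv :: "('o, 'm, 'z) cat_scheme \<Rightarrow> 'o \<Rightarrow> ('m \<times> 'm) set" where
  "subobj_equiv C X = {(f, g). f \<in> monos_into C X \<and> g \<in> monos_into C X \<and>
     (\<exists>h\<in>homs C (Dom C f) (Dom C g). iso_arr C h \<and> g \<bullet>\<^bsub>C\<^esub> h = f)}"

text \<open>A subobject is an equivalence class of monomorphisms, so \<open>f \<in> A\<close> says that \<open>f\<close>
  represents the subobject \<open>A\<close>. The meet and join of this order are the intersection and
  the sum of subobjects.\<close>

definition subobj_lattice :: "('o, 'm, 'z) cat_scheme \<Rightarrow> 'o \<Rightarrow> 'm set gorder" where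
  "subobj_lattice C X = \<lparr>carrier = monos_into C X // subobj_equiv C X, eq = (=),
     le = (\<lambda>A B. \<exists>f\<in>A. \<exists>g\<in>B. \<exists>h\<in>homs C (Dom C f) (Dom C g). g \<bullet>\<^bsub>C\<^esub> h = f)\<rparr>"

text \<open>All monomorphisms from zero objects into \<open>X\<close> are equivalent, and they form one class.\<close>

definition zero_subobj :: "('o, 'm, 'z) cat_scheme \<Rightarrow> 'o \<Rightarrow> 'm set" where
  "zero_subobj C X = {f \<in> monos_into C X. zero_object C (Dom C f)}"

definition whole_subobj :: "('o, 'm, 'z) cat_scheme \<Rightarrow> 'o \<Rightarrow> 'm set" where
  "whole_subobj C X = subobj_equiv C X `` {Idt C X}"


section \<open>Configurations\<close>

text \<open>The poset is a carrier \<open>I\<close> with its order \<open>r\<close> as a set of pairs: \<open>(i, j) \<in> r\<close> means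
  \<open>i \<preceq> j\<close>.\<close>

definition s_sets :: "'i set \<Rightarrow> 'i rel \<Rightarrow> 'i set set" where
  "s_sets I r = {J. J \<subseteq> I \<and> (\<forall>i\<in>I. \<forall>j\<in>J. (i, j) \<in> r \<longrightarrow> i \<in> J)}"

definition f_sets :: "'i set \<Rightarrow> 'i rel \<Rightarrow> 'i set set" where
  "f_sets I r = {J. J \<subseteq> I \<and>
     (\<forall>i\<in>I. \<forall>h\<in>J. \<forall>j\<in>J. (h, i) \<in> r \<and> (i, j) \<in> r \<longrightarrow> i \<in> J)}"

definition G_pairs :: "'i set \<Rightarrow> 'i rel \<Rightarrow> ('i set \<times> 'i set) set" where
  "G_pairs I r = {(J, K). J \<in> f_sets I r \<and> K \<in> f_sets I r \<and> J \<subseteq> K \<and>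
     (\<forall>j\<in>J. \<forall>k\<in>K. (k, j) \<in> r \<longrightarrow> k \<in> J)}"

definition H_pairs :: "'i set \<Rightarrow> 'i rel \<Rightarrow> ('i set \<times> 'i set) set" where
  "H_pairs I r = {(J, K). J \<in> f_sets I r \<and> K \<in> f_sets I r \<and> K \<subseteq> J \<and>
     (\<forall>j\<in>J. \<forall>k\<in>K. (k, j) \<in> r \<longrightarrow> j \<in> K)}"

text \<open>The components below are total functions; only their values at f-sets, at \<open>G_pairs\<close>
  and at \<open>H_pairs\<close> respectively carry meaning.\<close>

record ('i, 'o, 'm) config =
  csig :: "'i set \<Rightarrow> 'o"  (\<open>\<sigma>\<index>\<close>)
  cinj :: "'i set \<Rightarrow> 'i set \<Rightarrow> 'm"  (\<open>\<iota>\<index>\<close>)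
  cproj :: "'i set \<Rightarrow> 'i set \<Rightarrow> 'm"  (\<open>\<pi>\<index>\<close>)

locale configuration =
  fixes C :: "('o, 'm, 'z) additive_cat_scheme"
    and I :: "'i set" and r :: "'i rel"
    and S :: "('i, 'o, 'm) config" (structure)
  assumes sigma_Obj: "J \<in> f_sets I r \<Longrightarrow> \<sigma> J \<in> Obj C"
    and sigma_empty: "zero_object C (\<sigma> {})"
    and iota_homs: "(J, K) \<in> G_pairs I r \<Longrightarrow> \<iota> J K \<in> homs C (\<sigma> J) (\<sigma> K)"
    and iota_mono: "(J, K) \<in> G_pairs I r \<Longrightarrow> mono_arr C (\<iota> J K)"
    and iota_Idt: "J \<in> f_sets I r \<Longrightarrow> \<iota> J J = Idt C (\<sigma> J)"
    and pi_homs: "(J, K) \<in> H_pairs I r \<Longrightarrow> \<pi> J K \<in> homs C (\<sigma> J) (\<sigma> K)"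
    and pi_epi: "(J, K) \<in> H_pairs I r \<Longrightarrow> epi_arr C (\<pi> J K)"
    and pi_Idt: "J \<in> f_sets I r \<Longrightarrow> \<pi> J J = Idt C (\<sigma> J)"
    and exact: "(J, K) \<in> G_pairs I r \<Longrightarrow> short_exact C (\<iota> J K) (\<pi> K (K - J))"
    and iota_comp: "\<lbrakk>(J, K) \<in> G_pairs I r; (K, L) \<in> G_pairs I r\<rbrakk>
      \<Longrightarrow> \<iota> J L = \<iota> K L \<bullet>\<^bsub>C\<^esub> \<iota> J K"
    and pi_comp: "\<lbrakk>(J, K) \<in> H_pairs I r; (K, L) \<in> H_pairs I r\<rbrakk>
      \<Longrightarrow> \<pi> J L = \<pi> K L \<bullet>\<^bsub>C\<^esub> \<pi> J K"
    and pi_iota: "\<lbrakk>(J, K) \<in> G_pairs I r; (K, L) \<in> H_pairs I r\<rbrakk>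
      \<Longrightarrow> \<pi> K L \<bullet>\<^bsub>C\<^esub> \<iota> J K = \<iota> (J \<inter> L) L \<bullet>\<^bsub>C\<^esub> \<pi> J (J \<inter> L)"

text \<open>A morphism is a family indexed by the f-sets; extensionality (\<open>PiE\<close>) makes equality of
  families independent of values elsewhere.\<close>

definition config_morphism :: "('o, 'm, 'z) additive_cat_scheme \<Rightarrow> 'i set \<Rightarrow> 'i rel \<Rightarrow>
    ('i, 'o, 'm) config \<Rightarrow> ('i, 'o, 'm) config \<Rightarrow> ('i set \<Rightarrow> 'm) \<Rightarrow> bool" where
  "config_morphism C I r S T \<alpha> \<longleftrightarrow>
     \<alpha> \<in> (\<Pi>\<^sub>E J\<in>f_sets I r. homs C (\<sigma>\<^bsub>S\<^esub> J) (\<sigma>\<^bsub>T\<^esub> J)) \<and>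
     (\<forall>(J, K)\<in>G_pairs I r. \<alpha> K \<bullet>\<^bsub>C\<^esub> \<iota>\<^bsub>S\<^esub> J K = \<iota>\<^bsub>T\<^esub> J K \<bullet>\<^bsub>C\<^esub> \<alpha> J) \<and>
     (\<forall>(J, K)\<in>H_pairs I r. \<alpha> K \<bullet>\<^bsub>C\<^esub> \<pi>\<^bsub>S\<^esub> J K = \<pi>\<^bsub>T\<^esub> J K \<bullet>\<^bsub>C\<^esub> \<alpha> J)"

definition config_isomorphism :: "('o, 'm, 'z) additive_cat_scheme \<Rightarrow> 'i set \<Rightarrow> 'i rel \<Rightarrow>
    ('i, 'o, 'm) config \<Rightarrow> ('i, 'o, 'm) config \<Rightarrow> ('i set \<Rightarrow> 'm) \<Rightarrow> bool" where
  "config_isomorphism C I r S T \<alpha> \<longleftrightarrow> config_morphism C I r S T \<alpha> \<and>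
     (\<forall>J\<in>f_sets I r. iso_arr C (\<alpha> J))"

definition config_of_subobjs :: "('o, 'm, 'z) additive_cat_scheme \<Rightarrow> 'i set \<Rightarrow> 'i rel \<Rightarrow>
    'o \<Rightarrow> ('i set \<Rightarrow> 'm set) \<Rightarrow> ('i, 'o, 'm) config \<Rightarrow> bool" where
  "config_of_subobjs C I r X Sub S \<longleftrightarrow>
     configuration C I r S \<and> \<sigma>\<^bsub>S\<^esub> I = X \<and> (\<forall>J\<in>s_sets I r. \<iota>\<^bsub>S\<^esub> J I \<in> Sub J)"

end

theory Submission
  imports Defs
begin

text \<open>
  For an f-set \<open>J\<close> let \<open>N J\<close> be the set of elements of \<open>I\<close> that lie above no element of \<open>J\<close>,
  and let \<open>M J = N J \<union> J\<close>. Both are s-sets, \<open>M J\<close> is the largest s-set that contains \<open>J\<close> as an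
  upwards closed part, and \<open>J\<close> is the difference of the two. Write \<open>d A\<close> for the given
  subobject at the s-set \<open>A\<close>. The object attached to \<open>J\<close> is the subquotient \<open>d (M J) / d (N J)\<close>
  of \<open>X\<close>. The choice of the largest s-set, instead of the down closure of \<open>J\<close>, makes \<open>M\<close> and
  \<open>N\<close> grow along the surjections of a configuration.

  Every s-set \<open>Q \<subseteq> M J\<close> has a map \<open>res Q J : d Q \<rightarrow> d (M J) / d (N J)\<close>. The two lattice
  identities say what is needed about it: its kernel is \<open>d Q \<inter> d (N J)\<close>, the subobject of an intersection of
  s-sets (\<open>res_kernel\<close>), and it is epi if \<open>J \<subseteq> Q\<close>, because then \<open>d Q + d (N J)\<close> is \<open>d (M J)\<close>
  (\<open>res_epi\<close>). Hence \<open>res Q J\<close> is a cokernel, and a map out of the object of \<open>J\<close> is the same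
  as a map out of \<open>d Q\<close> that kills \<open>d (Q - J)\<close> (\<open>induced_map\<close>). The maps \<open>\<iota>\<close> and \<open>\<pi>\<close> are the ones
  with \<open>\<iota> J K \<bullet> res Q J = res Q K\<close> for \<open>Q \<subseteq> N K \<union> J\<close> and \<open>\<pi> J K \<bullet> res Q J = res Q K\<close> for
  \<open>Q \<subseteq> M J\<close>. Each identity between composites of \<open>\<iota>\<close> and \<open>\<pi>\<close> then holds after composition with
  one epimorphism \<open>res Q J\<close>, where both sides become the same \<open>res Q L\<close>. For the short exact
  sequence of \<open>(J, K)\<close>, the composite \<open>\<pi> K (K - J) \<bullet> res (M K) K\<close> has kernel \<open>d Q\<close> with
  \<open>Q = N K \<union> J\<close>, and \<open>\<iota> J K\<close> is the image of this kernel in the object of \<open>K\<close>; so \<open>\<pi>\<close> is its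
  cokernel (\<open>cokernel_of_induced\<close>).

  Conversely a configuration is determined by its monomorphisms into \<open>X\<close>. A morphism
  \<open>\<alpha>\<close> with \<open>\<alpha> I = id\<close> is determined on s-sets because \<open>\<iota> J I\<close> is mono, and then on each f-set \<open>J\<close>
  because \<open>\<pi> (M J) J\<close> is epi. The same two facts construct it: on s-sets from the
  comparison of two representatives of one subobject, on f-sets by passing to cokernels.
  Morphisms in the two directions are mutually inverse by uniqueness.
\<close>

section \<open>Kernels and cokernels in abelian categories\<close>

context category
begin

lemma homsE:
  assumes "f \<in> homs C X Y"
  shows "f \<in> Arr C" "Dom C f = X" "Cod C f = Y" "X \<in> Obj C" "Y \<in> Obj C"
  using assms Dom_Obj Cod_Obj by (auto simp: homs_def)

lemma mono_cancel:
  assumes "mono_arr C f" "f \<in> homs C X Y" "g \<in> homs C W X" "h \<in> homs C W X" "f \<bullet> g = f \<bullet> h"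
  shows "g = h"
  using assms homsE(4)[OF assms(3)] homsE(2)[OF assms(2)] unfolding mono_arr_def by blast

lemma epi_cancel:
  assumes "epi_arr C f" "f \<in> homs C X Y" "g \<in> homs C Y W" "h \<in> homs C Y W" "g \<bullet> f = h \<bullet> f"
  shows "g = h"
  using assms homsE(5)[OF assms(3)] homsE(3)[OF assms(2)] unfolding epi_arr_def by blast

lemma mono_arrI:
  assumes "f \<in> homs C X Y"
    and "\<And>W g h. \<lbrakk>g \<in> homs C W X; h \<in> homs C W X; f \<bullet> g = f \<bullet> h\<rbrakk> \<Longrightarrow> g = h"
  shows "mono_arr C f"
  using assms by (auto simp: mono_arr_def homs_def)

lemma epi_arrI:
  assumes "f \<in> homs C X Y"
    and "\<And>W g h. \<lbrakk>g \<in> homs C Y W; h \<in> homs C Y W; g \<bullet> f = h \<bullet> f\<rbrakk> \<Longrightarrow> g = h"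
  shows "epi_arr C f"
  using assms by (auto simp: epi_arr_def homs_def)

lemma mono_Idt: "X \<in> Obj C \<Longrightarrow> mono_arr C (Idt C X)"
  by (rule mono_arrI[OF Idt_homs]) (auto simp: Idt_Comp)

lemma mono_comp:
  assumes f: "f \<in> homs C X Y" "mono_arr C f" and g: "g \<in> homs C Y Z" "mono_arr C g"
  shows "mono_arr C (g \<bullet> f)"
proof (rule mono_arrI[OF Comp_homs[OF f(1) g(1)]])
  fix W u v assume uv: "u \<in> homs C W X" "v \<in> homs C W X" "g \<bullet> f \<bullet> u = g \<bullet> f \<bullet> v"
  then have "g \<bullet> (f \<bullet> u) = g \<bullet> (f \<bullet> v)" using Comp_assoc[OF _ f(1) g(1)] by simp
  then show "u = v"
    using mono_cancel[OF f(2,1) uv(1,2)] mono_cancel[OF g(2,1)] Comp_homs[OF _ f(1)] uv by blast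
qed

lemma epi_comp:
  assumes f: "f \<in> homs C X Y" "epi_arr C f" and g: "g \<in> homs C Y Z" "epi_arr C g"
  shows "epi_arr C (g \<bullet> f)"
proof (rule epi_arrI[OF Comp_homs[OF f(1) g(1)]])
  fix W u v assume uv: "u \<in> homs C Z W" "v \<in> homs C Z W" "u \<bullet> (g \<bullet> f) = v \<bullet> (g \<bullet> f)"
  then have "u \<bullet> g \<bullet> f = v \<bullet> g \<bullet> f" using Comp_assoc[OF f(1) g(1)] by simp
  then show "u = v"
    using epi_cancel[OF g(2,1) uv(1,2)] epi_cancel[OF f(2,1)] Comp_homs[OF g(1)] uv by blast
qed

lemma mono_right_factor:
  assumes f: "f \<in> homs C X Y" and g: "g \<in> homs C Y Z" and "mono_arr C (g \<bullet> f)"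
  shows "mono_arr C f"
proof (rule mono_arrI[OF f])
  fix W u v assume uv: "u \<in> homs C W X" "v \<in> homs C W X" "f \<bullet> u = f \<bullet> v"
  then have "g \<bullet> f \<bullet> u = g \<bullet> f \<bullet> v" using Comp_assoc[OF _ f g] by simp
  then show "u = v" using mono_cancel[OF assms(3) Comp_homs[OF f g] uv(1,2)] by blast
qed

lemma epi_left_factor:
  assumes f: "f \<in> homs C X Y" and g: "g \<in> homs C Y Z" and "epi_arr C (g \<bullet> f)"
  shows "epi_arr C g"
proof (rule epi_arrI[OF g])
  fix W u v assume uv: "u \<in> homs C Z W" "v \<in> homs C Z W" "u \<bullet> g = v \<bullet> g"
  then have "u \<bullet> (g \<bullet> f) = v \<bullet> (g \<bullet> f)" using Comp_assoc[OF f g] by metis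
  then show "u = v" using epi_cancel[OF assms(3) Comp_homs[OF f g] uv(1,2)] by blast
qed

lemma iso_arrI:
  assumes "f \<in> homs C X Y" "g \<in> homs C Y X" "g \<bullet> f = Idt C X" "f \<bullet> g = Idt C Y"
  shows "iso_arr C f"
  using assms homsE[OF assms(1)] unfolding iso_arr_def by blast

end

context preadditive_category
begin

lemma Zero_homs: "\<lbrakk>X \<in> Obj C; Y \<in> Obj C\<rbrakk> \<Longrightarrow> Zero C X Y \<in> homs C X Y"
  using monoid.one_closed[OF comm_group.axioms(1)[OF homs_comm_group, THEN comm_monoid.axioms(1)]]
  by fastforce

lemma hom_group: "\<lbrakk>X \<in> Obj C; Y \<in> Obj C\<rbrakk>
    \<Longrightarrow> group \<lparr>carrier = homs C X Y, monoid.mult = Add C, one = Zero C X Y\<rparr>"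
  using homs_comm_group comm_group.axioms(2) by blast

lemma Comp_Zero:
  assumes f: "f \<in> homs C X Y" and W: "W \<in> Obj C"
  shows "f \<bullet> Zero C W X = Zero C W Y"
proof -
  note XY = homsE(4,5)[OF f]
  interpret A: group "\<lparr>carrier = homs C W X, monoid.mult = Add C, one = Zero C W X\<rparr>"
    using hom_group W XY by blast
  interpret B: group "\<lparr>carrier = homs C W Y, monoid.mult = Add C, one = Zero C W Y\<rparr>"
    using hom_group W XY by blast
  have Z: "Zero C W X \<in> homs C W X" using Zero_homs W XY by blast
  have "Zero C W X \<boxplus> Zero C W X = Zero C W X" using A.l_one Z by simp
  then have "f \<bullet> Zero C W X \<boxplus> f \<bullet> Zero C W X = f \<bullet> Zero C W X"
    using Comp_Add[OF Z Z f] by simp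
  then show ?thesis using B.l_cancel_one[of "f \<bullet> Zero C W X"] Comp_homs[OF Z f] by simp
qed

lemma Zero_Comp:
  assumes f: "f \<in> homs C X Y" and W: "W \<in> Obj C"
  shows "Zero C Y W \<bullet> f = Zero C X W"
proof -
  note XY = homsE(4,5)[OF f]
  interpret A: group "\<lparr>carrier = homs C Y W, monoid.mult = Add C, one = Zero C Y W\<rparr>"
    using hom_group W XY by blast
  interpret B: group "\<lparr>carrier = homs C X W, monoid.mult = Add C, one = Zero C X W\<rparr>"
    using hom_group W XY by blast
  have Z: "Zero C Y W \<in> homs C Y W" using Zero_homs W XY by blast
  have "Zero C Y W \<boxplus> Zero C Y W = Zero C Y W" using A.l_one Z by simp
  then have "Zero C Y W \<bullet> f \<boxplus> Zero C Y W \<bullet> f = Zero C Y W \<bullet> f"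
    using Add_Comp[OF f Z Z] by simp
  then show ?thesis using B.l_cancel_one[of "Zero C Y W \<bullet> f"] Comp_homs[OF f Z] by simp
qed

text \<open>Apply the hypothesis to the difference of two maps with the same composite. The
  difference is formed in the group of morphisms, whose laws relate it back to the two maps.\<close>

lemma mono_arrI_zero:
  assumes f: "f \<in> homs C X Y"
    and zero: "\<And>W g. \<lbrakk>g \<in> homs C W X; f \<bullet> g = Zero C W Y\<rbrakk> \<Longrightarrow> g = Zero C W X"
  shows "mono_arr C f"
proof (rule mono_arrI[OF f])
  fix W g h assume g: "g \<in> homs C W X" and h: "h \<in> homs C W X" and eq: "f \<bullet> g = f \<bullet> h"
  let ?A = "\<lparr>carrier = homs C W X, monoid.mult = Add C, one = Zero C W X\<rparr>"
  interpret A: group ?A using hom_group homsE(4,5)[OF g] by blast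
  interpret B: group "\<lparr>carrier = homs C W Y, monoid.mult = Add C, one = Zero C W Y\<rparr>"
    using hom_group homsE(4)[OF g] homsE(5)[OF f] by blast
  define d where "d = g \<boxplus> inv\<^bsub>?A\<^esub> h"
  have inv: "inv\<^bsub>?A\<^esub> h \<in> homs C W X" using A.inv_closed[of h] h by simp
  have d: "d \<in> homs C W X" using A.m_closed[of g "inv\<^bsub>?A\<^esub> h"] g inv by (simp add: d_def)
  have dh: "d \<boxplus> h = g"
    using A.m_assoc[of g "inv\<^bsub>?A\<^esub> h" h] A.l_inv[of h] A.r_one[of g] g h inv by (simp add: d_def)
  have fd: "f \<bullet> d \<in> homs C W Y" and fh: "f \<bullet> h \<in> homs C W Y" using Comp_homs f d h by blast+
  have "f \<bullet> d \<boxplus> f \<bullet> h = f \<bullet> h" using Comp_Add[OF d h f] dh eq by simp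
  then have "f \<bullet> d = Zero C W Y" using B.r_cancel_one[of "f \<bullet> h" "f \<bullet> d"] fd fh by simp
  then have "d = Zero C W X" using zero d by blast
  then show "g = h" using dh A.l_one[of h] h by simp
qed

lemma epi_arrI_zero:
  assumes f: "f \<in> homs C X Y"
    and zero: "\<And>W g. \<lbrakk>g \<in> homs C Y W; g \<bullet> f = Zero C X W\<rbrakk> \<Longrightarrow> g = Zero C Y W"
  shows "epi_arr C f"
proof (rule epi_arrI[OF f])
  fix W g h assume g: "g \<in> homs C Y W" and h: "h \<in> homs C Y W" and eq: "g \<bullet> f = h \<bullet> f"
  let ?A = "\<lparr>carrier = homs C Y W, monoid.mult = Add C, one = Zero C Y W\<rparr>"
  interpret A: group ?A using hom_group homsE(4,5)[OF g] by blast
  interpret B: group "\<lparr>carrier = homs C X W, monoid.mult = Add C, one = Zero C X W\<rparr>"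
    using hom_group homsE(5)[OF g] homsE(4)[OF f] by blast
  define d where "d = g \<boxplus> inv\<^bsub>?A\<^esub> h"
  have inv: "inv\<^bsub>?A\<^esub> h \<in> homs C Y W" using A.inv_closed[of h] h by simp
  have d: "d \<in> homs C Y W" using A.m_closed[of g "inv\<^bsub>?A\<^esub> h"] g inv by (simp add: d_def)
  have dh: "d \<boxplus> h = g"
    using A.m_assoc[of g "inv\<^bsub>?A\<^esub> h" h] A.l_inv[of h] A.r_one[of g] g h inv by (simp add: d_def)
  have df: "d \<bullet> f \<in> homs C X W" and hf: "h \<bullet> f \<in> homs C X W" using Comp_homs f d h by blast+
  have "d \<bullet> f \<boxplus> h \<bullet> f = h \<bullet> f" using Add_Comp[OF f d h] dh eq by simp
  then have "d \<bullet> f = Zero C X W" using B.r_cancel_one[of "h \<bullet> f" "d \<bullet> f"] df hf by simp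
  then have "d = Zero C Y W" using zero d by blast
  then show "g = h" using dh A.l_one[of h] h by simp
qed

lemma zero_object_from: "\<lbrakk>zero_object C Z; f \<in> homs C Z Y\<rbrakk> \<Longrightarrow> f = Zero C Z Y"
  using Zero_homs homsE unfolding zero_object_def by metis

lemma zero_object_to: "\<lbrakk>zero_object C Z; f \<in> homs C Y Z\<rbrakk> \<Longrightarrow> f = Zero C Y Z"
  using Zero_homs homsE unfolding zero_object_def by metis

lemma zero_objectI:
  assumes Z: "Z \<in> Obj C" and "Idt C Z = Zero C Z Z"
  shows "zero_object C Z"
proof -
  have "f = Zero C Z Y" if "f \<in> homs C Z Y" for f Y
    using Comp_Idt[OF that] Comp_Zero[OF that Z] assms(2) by simp
  moreover have "f = Zero C Y Z" if "f \<in> homs C Y Z" for f Y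
    using Idt_Comp[OF that] Zero_Comp[OF that Z] assms(2) by simp
  ultimately show ?thesis using Z Zero_homs unfolding zero_object_def by metis
qed

lemma is_kernelI:
  assumes "f \<in> homs C Y Z" "k \<in> homs C X Y" "mono_arr C k" "f \<bullet> k = Zero C X Z"
    and "\<And>W g. \<lbrakk>g \<in> homs C W Y; f \<bullet> g = Zero C W Z\<rbrakk> \<Longrightarrow> \<exists>h\<in>homs C W X. k \<bullet> h = g"
  shows "is_kernel C k f"
  unfolding is_kernel_def homsE(2,3)[OF assms(1)] homsE(2,3)[OF assms(2)]
  using assms(4,5) homsE(1)[OF assms(1)] homsE(1)[OF assms(2)] mono_cancel[OF assms(3,2)]
  by (metis (full_types))

lemma is_kernelD:
  assumes "is_kernel C k f" "f \<in> homs C Y Z"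
  shows "k \<in> homs C (Dom C k) Y" "mono_arr C k" "f \<bullet> k = Zero C (Dom C k) Z"
    and "\<lbrakk>g \<in> homs C W Y; f \<bullet> g = Zero C W Z\<rbrakk> \<Longrightarrow> \<exists>h\<in>homs C W (Dom C k). k \<bullet> h = g"
proof -
  note fD = homsE[OF assms(2)]
  show k: "k \<in> homs C (Dom C k) Y" and fk: "f \<bullet> k = Zero C (Dom C k) Z"
    using assms(1) fD unfolding is_kernel_def homs_def by auto
  show "mono_arr C k"
  proof (rule mono_arrI[OF k])
    fix W g h assume gh: "g \<in> homs C W (Dom C k)" "h \<in> homs C W (Dom C k)" "k \<bullet> g = k \<bullet> h"
    have "f \<bullet> (k \<bullet> g) = Zero C W Z"
      using Comp_assoc[OF gh(1) k assms(2)] fk Zero_Comp[OF gh(1) fD(5)] by simp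
    then have "\<exists>!h. h \<in> homs C W (Dom C k) \<and> k \<bullet> h = k \<bullet> g"
      using assms(1) Comp_homs[OF gh(1) k] homsE(4)[OF gh(1)] fD unfolding is_kernel_def by auto
    then show "g = h" using gh by metis
  qed
  show "\<exists>h\<in>homs C W (Dom C k). k \<bullet> h = g" if "g \<in> homs C W Y" "f \<bullet> g = Zero C W Z"
    using that assms(1) fD homsE(4)[OF that(1)] unfolding is_kernel_def by simp metis
qed

lemma is_cokernelI:
  assumes "f \<in> homs C Y Z" "c \<in> homs C Z X" "epi_arr C c" "c \<bullet> f = Zero C Y X"
    and "\<And>W g. \<lbrakk>g \<in> homs C Z W; g \<bullet> f = Zero C Y W\<rbrakk> \<Longrightarrow> \<exists>h\<in>homs C X W. h \<bullet> c = g"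
  shows "is_cokernel C c f"
  unfolding is_cokernel_def homsE(2,3)[OF assms(1)] homsE(2,3)[OF assms(2)]
  using assms(4,5) homsE(1)[OF assms(1)] homsE(1)[OF assms(2)] epi_cancel[OF assms(3,2)]
  by (metis (full_types))

lemma is_cokernelD:
  assumes "is_cokernel C c f" "f \<in> homs C Y Z"
  shows "c \<in> homs C Z (Cod C c)" "epi_arr C c" "c \<bullet> f = Zero C Y (Cod C c)"
    and "\<lbrakk>g \<in> homs C Z W; g \<bullet> f = Zero C Y W\<rbrakk> \<Longrightarrow> \<exists>h\<in>homs C (Cod C c) W. h \<bullet> c = g"
proof -
  note fD = homsE[OF assms(2)]
  show c: "c \<in> homs C Z (Cod C c)" and cf: "c \<bullet> f = Zero C Y (Cod C c)"
    using assms(1) fD unfolding is_cokernel_def homs_def by auto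
  show "epi_arr C c"
  proof (rule epi_arrI[OF c])
    fix W g h assume gh: "g \<in> homs C (Cod C c) W" "h \<in> homs C (Cod C c) W" "g \<bullet> c = h \<bullet> c"
    have "(g \<bullet> c) \<bullet> f = Zero C Y W"
      using Comp_assoc[OF assms(2) c gh(1)] cf Comp_Zero[OF gh(1) fD(4)] by simp
    then have "\<exists>!h. h \<in> homs C (Cod C c) W \<and> h \<bullet> c = g \<bullet> c"
      using assms(1) Comp_homs[OF c gh(1)] homsE(5)[OF gh(1)] fD unfolding is_cokernel_def by auto
    then show "g = h" using gh by metis
  qed
  show "\<exists>h\<in>homs C (Cod C c) W. h \<bullet> c = g" if "g \<in> homs C Z W" "g \<bullet> f = Zero C Y W"
    using that assms(1) fD homsE(5)[OF that(1)] unfolding is_cokernel_def by simp metis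
qed

end

context abelian_category
begin

text \<open>A mono is a kernel of some \<open>g\<close>, and \<open>g\<close> factors through the cokernel of the mono, so
  whatever the cokernel kills, \<open>g\<close> kills too.\<close>

lemma mono_is_kernel:
  assumes m: "m \<in> homs C X Y" "mono_arr C m" and c: "is_cokernel C c m"
  shows "is_kernel C m c"
proof -
  note cD = is_cokernelD[OF c m(1)]
  obtain g where g: "is_kernel C m g" using mono_normal m(2) by blast
  define W where "W = Cod C g"
  have gh: "g \<in> homs C Y W" using g homsE(3)[OF m(1)] by (auto simp: is_kernel_def homs_def W_def)
  note gD = is_kernelD[OF g gh] and mD = homsE[OF m(1)]
  obtain t where t: "t \<in> homs C (Cod C c) W" "t \<bullet> c = g" using cD(4)[OF gh] gD(3) mD by auto
  show ?thesis
  proof (rule is_kernelI[OF cD(1) m cD(3)])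
    fix V u assume u: "u \<in> homs C V Y" "c \<bullet> u = Zero C V (Cod C c)"
    have "g \<bullet> u = Zero C V W"
      using Comp_assoc[OF u(1) cD(1) t(1)] u(2) t Comp_Zero[OF t(1) homsE(4)[OF u(1)]] by simp
    then show "\<exists>h\<in>homs C V X. m \<bullet> h = u" using gD(4)[OF u(1)] mD by auto
  qed
qed

lemma epi_is_cokernel:
  assumes e: "e \<in> homs C Y Z" "epi_arr C e" and k: "is_kernel C k e"
  shows "is_cokernel C e k"
proof -
  note kD = is_kernelD[OF k e(1)]
  obtain g where g: "is_cokernel C e g" using epi_normal e(2) by blast
  define W where "W = Dom C g"
  have gh: "g \<in> homs C W Y" using g homsE(2)[OF e(1)] by (auto simp: is_cokernel_def homs_def W_def)
  note gD = is_cokernelD[OF g gh] and eD = homsE[OF e(1)]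
  obtain t where t: "t \<in> homs C W (Dom C k)" "k \<bullet> t = g" using kD(4)[OF gh] gD(3) eD by auto
  show ?thesis
  proof (rule is_cokernelI[OF kD(1) e kD(3)])
    fix V u assume u: "u \<in> homs C Y V" "u \<bullet> k = Zero C (Dom C k) V"
    have "u \<bullet> g = Zero C W V"
      using Comp_assoc[OF t(1) kD(1) u(1)] u(2) t Zero_Comp[OF t(1) homsE(5)[OF u(1)]] by simp
    then show "\<exists>h\<in>homs C Z V. h \<bullet> e = u" using gD(4)[OF u(1)] eD by auto
  qed
qed

text \<open>The cokernel of an epi is zero, so a mono that is also epi is the kernel of a zero map
  and the identity of the codomain factors through it. This section is the inverse.\<close>

lemma mono_epi_iso:
  assumes f: "f \<in> homs C X Y" "mono_arr C f" "epi_arr C f"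
  obtains g where "g \<in> homs C Y X" "g \<bullet> f = Idt C X" "f \<bullet> g = Idt C Y"
proof -
  note fD = homsE[OF f(1)]
  obtain c where c: "is_cokernel C c f" using ex_cokernel fD by blast
  note cD = is_cokernelD[OF c f(1)] and XY = fD(4,5)
  have Z: "Cod C c \<in> Obj C" using homsE[OF cD(1)] by blast
  have "c \<bullet> f = Zero C Y (Cod C c) \<bullet> f" using cD(3) Zero_Comp[OF f(1) Z] by simp
  \<comment> \<open>f is epi, so its cokernel vanishes\<close>
  then have c0: "c = Zero C Y (Cod C c)"
    using epi_cancel[OF f(3,1) cD(1)] Zero_homs Z XY by blast
  have "c \<bullet> Idt C Y = Zero C Y (Cod C c)" using Comp_Idt[OF cD(1)] c0 by simp
  then obtain g where g: "g \<in> homs C Y X" "f \<bullet> g = Idt C Y"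
    using is_kernelD(4)[OF mono_is_kernel[OF f(1,2) c] cD(1) Idt_homs[OF XY(2)]] fD by auto
  have "f \<bullet> (g \<bullet> f) = f \<bullet> Idt C X"
    using Comp_assoc[OF f(1) g(1) f(1)] g(2) Idt_Comp[OF f(1)] Comp_Idt[OF f(1)] by simp
  then have "g \<bullet> f = Idt C X"
    using mono_cancel[OF f(2,1) Comp_homs[OF f(1) g(1)]] Idt_homs XY by blast
  then show ?thesis using that g by blast
qed

text \<open>The definition of exactness asks for an image at each of the three places: the zero
  map at the source, \<open>f\<close> itself in the middle and the identity of the target.\<close>

lemma short_exactI:
  assumes f: "f \<in> homs C X Y" "mono_arr C f" and g: "is_cokernel C g f"
  shows "short_exact C f g"
proof -
  define W where "W = Cod C g"
  note gD = is_cokernelD[OF g f(1), folded W_def] and fD = homsE[OF f(1)]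
  note gh = homsE[OF gD(1)]
  obtain Z where Z: "zero_object C Z" using ex_zero_object by blast
  then have ZO: "Z \<in> Obj C" by (simp add: zero_object_def)
  let ?a = "Zero C Z X" and ?b = "Zero C W Z"
  have a: "?a \<in> homs C Z X" and b: "?b \<in> homs C W Z" using Zero_homs ZO fD gh by blast+
  have "mono_arr C ?a"
    by (rule mono_arrI[OF a]) (use zero_object_to[OF Z] in metis)
  have ka: "is_kernel C ?a h" if h: "h \<in> homs C X V" "mono_arr C h" for h V
  proof (rule is_kernelI[OF h(1) a \<open>mono_arr C ?a\<close> Comp_Zero[OF h(1) ZO]])
    fix U u assume u: "u \<in> homs C U X" "h \<bullet> u = Zero C U V"
    note UO = homsE(4)[OF u(1)]
    have "u = Zero C U X"
      using mono_cancel[OF h(2,1) u(1) Zero_homs] u(2) Comp_Zero[OF h(1) UO] UO fD by simp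
    moreover have "?a \<bullet> Zero C U Z = Zero C U X" using Comp_Zero[OF a UO] .
    ultimately show "\<exists>v\<in>homs C U Z. ?a \<bullet> v = u" using Zero_homs[OF UO ZO] by auto
  qed
  have "is_cokernel C (Idt C X) ?a"
  proof (rule is_cokernelI[OF a Idt_homs])
    show "epi_arr C (Idt C X)"
      by (rule epi_arrI[OF Idt_homs]) (use fD Comp_Idt in auto)
    show "Idt C X \<bullet> ?a = Zero C Z X" using Idt_Comp[OF a] .
    show "\<exists>h\<in>homs C X V. h \<bullet> Idt C X = u" if "u \<in> homs C X V" for u V
      using that Comp_Idt by blast
  qed (use fD in auto)
  then have "is_image C ?a ?a"
    using ka[OF Idt_homs mono_Idt] fD unfolding is_image_def by blast
  then have 1: "exact_pair C (Zero C Z (Dom C f)) f"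
    using ka[OF f] fD unfolding exact_pair_def by auto
  have "is_kernel C f g" using mono_is_kernel[OF f g] .
  then have 2: "exact_pair C f g" using g unfolding exact_pair_def is_image_def by blast
  have kb: "is_kernel C (Idt C W) ?b"
  proof (rule is_kernelI[OF b Idt_homs mono_Idt])
    show "?b \<bullet> Idt C W = Zero C W Z" using Comp_Idt[OF b] .
    show "\<exists>h\<in>homs C V W. Idt C W \<bullet> h = u" if "u \<in> homs C V W" for u V
      using that Idt_Comp by blast
  qed (use gh in auto)
  have "is_cokernel C ?b g"
  proof (rule is_cokernelI[OF gD(1) b])
    show "epi_arr C ?b"
      by (rule epi_arrI[OF b]) (use zero_object_from[OF Z] in metis)
    show "?b \<bullet> g = Zero C Y Z" using Zero_Comp[OF gD(1) ZO] .
    fix V u assume u: "u \<in> homs C W V" "u \<bullet> g = Zero C Y V"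
    note VO = homsE(5)[OF u(1)]
    have "u = Zero C W V"
      using epi_cancel[OF gD(2,1) u(1) Zero_homs] u(2) Zero_Comp[OF gD(1) VO] VO gh by simp
    moreover have "Zero C Z V \<bullet> ?b = Zero C W V" using Zero_Comp[OF b VO] .
    ultimately show "\<exists>v\<in>homs C Z V. v \<bullet> ?b = u" using Zero_homs[OF ZO VO] by auto
  qed
  then have 3: "exact_pair C g (Zero C (Cod C g) Z)"
    using kb unfolding exact_pair_def is_image_def W_def by blast
  show ?thesis using 1 2 3 Z unfolding short_exact_def by blast
qed

text \<open>Exactness in the middle gives one subobject that is the kernel of \<open>g\<close> and of the
  cokernel of \<open>f\<close>. An epimorphism is the cokernel of its kernel, so both are the same quotient.\<close>

lemma short_exact_cokernel:
  assumes "short_exact C f g" and f: "f \<in> homs C X Y" and g: "g \<in> homs C Y Z" "epi_arr C g"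
  shows "is_cokernel C g f"
proof -
  obtain m c where c: "is_cokernel C c f" and m: "is_kernel C m c" "is_kernel C m g"
    using assms(1) unfolding short_exact_def exact_pair_def is_image_def by blast
  note cD = is_cokernelD[OF c f]
  note mc = is_kernelD[OF m(1) cD(1)] and mg = is_kernelD[OF m(2) g(1)]
  have gm: "is_cokernel C g m" using epi_is_cokernel[OF g m(2)] .
  obtain t where t: "t \<in> homs C X (Dom C m)" "m \<bullet> t = f" using mc(4)[OF f cD(3)] by blast
  have gZ: "Cod C g = Z" using homsE[OF g(1)] by blast
  show ?thesis
  proof (rule is_cokernelI[OF f g])
    show "g \<bullet> f = Zero C X Z"
      using Comp_assoc[OF t(1) mg(1) g(1)] t mg(3) Zero_Comp[OF t(1)] homsE(5)[OF g(1)] by simp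
    fix W u assume u: "u \<in> homs C Y W" "u \<bullet> f = Zero C X W"
    obtain v where v: "v \<in> homs C (Cod C c) W" "v \<bullet> c = u" using cD(4)[OF u] by blast
    have "u \<bullet> m = Zero C (Dom C m) W"
      using Comp_assoc[OF mc(1) cD(1) v(1)] v mc(3) Comp_Zero[OF v(1) homsE(4)[OF mc(1)]] by simp
    then show "\<exists>h\<in>homs C Z W. h \<bullet> g = u" using is_cokernelD(4)[OF gm mg(1) u(1)] gZ by auto
  qed
qed

text \<open>The third isomorphism theorem in the form that produces the exact sequences of a
  configuration: if \<open>V\<close> is the kernel of \<open>Y \<rightarrow> Z \<rightarrow> W\<close> and \<open>U\<close> is the image of \<open>V\<close> in \<open>Z\<close>, then
  \<open>W = Z / U\<close>. It avoids pullbacks because the composite \<open>p \<bullet> e\<close> is the cokernel of its own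
  kernel.\<close>

lemma cokernel_of_induced:
  assumes e: "e \<in> homs C Y Z" "epi_arr C e" and p: "p \<in> homs C Z W" "epi_arr C p"
    and k: "is_kernel C k (p \<bullet> e)" "k \<in> homs C V Y"
    and q: "q \<in> homs C V U" "epi_arr C q" and i: "i \<in> homs C U Z" and comm: "e \<bullet> k = i \<bullet> q"
  shows "is_cokernel C p i"
proof (rule is_cokernelI[OF i p])
  have pe: "p \<bullet> e \<in> homs C Y W" "epi_arr C (p \<bullet> e)"
    using Comp_homs[OF e(1) p(1)] epi_comp[OF e p] .
  have c: "is_cokernel C (p \<bullet> e) k" using epi_is_cokernel[OF pe k(1)] .
  have "p \<bullet> i \<bullet> q = Zero C V W"
    using Comp_assoc[OF q(1) i p(1)] Comp_assoc[OF k(2) e(1) p(1)] comm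
      is_kernelD(3)[OF k(1) pe(1)] homsE(2)[OF k(2)] by simp
  also have "\<dots> = Zero C U W \<bullet> q" using Zero_Comp[OF q(1)] homsE(5)[OF p(1)] by simp
  finally show "p \<bullet> i = Zero C U W"
    using epi_cancel[OF q(2,1) Comp_homs[OF i p(1)] Zero_homs] homsE(4)[OF i] homsE(5)[OF p(1)]
    by blast
  fix T h assume h: "h \<in> homs C Z T" "h \<bullet> i = Zero C U T"
  have "h \<bullet> e \<bullet> k = h \<bullet> i \<bullet> q"
    using Comp_assoc[OF q(1) i h(1)] Comp_assoc[OF k(2) e(1) h(1)] comm by simp
  also have "\<dots> = Zero C V T" using h(2) Zero_Comp[OF q(1)] homsE(5)[OF h(1)] by simp
  finally obtain t where t: "t \<in> homs C W T" "t \<bullet> (p \<bullet> e) = h \<bullet> e"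
    using is_cokernelD(4)[OF c k(2) Comp_homs[OF e(1) h(1)]] homsE(3)[OF pe(1)] by auto
  then have "t \<bullet> p = h"
    using epi_cancel[OF e(2,1) Comp_homs[OF p(1) t(1)] h(1)] Comp_assoc[OF e(1) p(1) t(1)] by simp
  then show "\<exists>h'\<in>homs C W T. h' \<bullet> p = h" using t by blast
qed

text \<open>If \<open>f \<bullet> e\<close> kills no more than \<open>e\<close> does, then \<open>f\<close> kills nothing. Suppose \<open>f \<bullet> g = 0\<close>
  and let \<open>c\<close> be the cokernel of \<open>g\<close>. Then \<open>c \<bullet> e\<close> lies between \<open>e\<close> and \<open>f \<bullet> e\<close>, so it has the
  same kernel, and it is epi; hence \<open>e\<close> factors through it, which makes \<open>c\<close> split mono and
  \<open>g = 0\<close>.\<close>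

lemma mono_of_kernels:
  assumes e: "e \<in> homs C Y Z" "epi_arr C e" and f: "f \<in> homs C Z W"
    and k: "is_kernel C k (f \<bullet> e)" "k \<in> homs C V Y" and ek: "e \<bullet> k = Zero C V Z"
  shows "mono_arr C f"
proof (rule mono_arrI_zero[OF f])
  fix T g assume g: "g \<in> homs C T Z" "f \<bullet> g = Zero C T W"
  have fe: "f \<bullet> e \<in> homs C Y W" using Comp_homs[OF e(1) f] .
  obtain c where c: "is_cokernel C c g" using ex_cokernel homsE(1)[OF g(1)] by blast
  note cD = is_cokernelD[OF c g(1)]
  define U where "U = Cod C c"
  note cD = cD[folded U_def]
  have UO: "U \<in> Obj C" using homsE(5)[OF cD(1)] .
  obtain f' where f': "f' \<in> homs C U W" "f' \<bullet> c = f" using cD(4)[OF f g(2)] by blast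
  have ce: "c \<bullet> e \<in> homs C Y U" "epi_arr C (c \<bullet> e)" using Comp_homs[OF e(1) cD(1)] epi_comp[OF e cD(1,2)] .
  have "is_kernel C k (c \<bullet> e)"
  proof (rule is_kernelI[OF ce(1) k(2) is_kernelD(2)[OF k(1) fe]])
    show "c \<bullet> e \<bullet> k = Zero C V U"
      using Comp_assoc[OF k(2) e(1) cD(1)] ek Comp_Zero[OF cD(1) homsE(4)[OF k(2)]] by simp
    fix S h assume h: "h \<in> homs C S Y" "c \<bullet> e \<bullet> h = Zero C S U"
    have "f \<bullet> e \<bullet> h = f' \<bullet> (c \<bullet> e \<bullet> h)"
      using Comp_assoc[OF e(1) cD(1) f'(1)] Comp_assoc[OF h(1) ce(1) f'(1)] f'(2) by simp
    also have "\<dots> = Zero C S W" using h(2) Comp_Zero[OF f'(1) homsE(4)[OF h(1)]] by simp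
    finally show "\<exists>v\<in>homs C S V. k \<bullet> v = h"
      using is_kernelD(4)[OF k(1) fe h(1)] homsE(2)[OF k(2)] by auto
  qed
  then have "is_cokernel C (c \<bullet> e) k" using epi_is_cokernel[OF ce] by blast
  then obtain t where t: "t \<in> homs C U Z" "t \<bullet> (c \<bullet> e) = e"
    using is_cokernelD(4)[OF _ k(2) e(1) ek] homsE(3)[OF ce(1)] by auto
  have ZO: "Z \<in> Obj C" using homsE(4)[OF f] .
  have "t \<bullet> c \<bullet> e = Idt C Z \<bullet> e"
    using Comp_assoc[OF e(1) cD(1) t(1)] t(2) Idt_Comp[OF e(1)] by simp
  then have tc: "t \<bullet> c = Idt C Z"
    using epi_cancel[OF e(2,1) Comp_homs[OF cD(1) t(1)] Idt_homs[OF ZO]] by blast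
  have "g = t \<bullet> (c \<bullet> g)" using Comp_assoc[OF g(1) cD(1) t(1)] tc Idt_Comp[OF g(1)] by simp
  also have "\<dots> = Zero C T Z" using cD(3) Comp_Zero[OF t(1) homsE(4)[OF g(1)]] by simp
  finally show "g = Zero C T Z" .
qed

end

section \<open>Intersections and sums of subobjects\<close>

definition factors :: "('o, 'm, 'z) cat_scheme \<Rightarrow> 'm \<Rightarrow> 'm \<Rightarrow> bool" where
  "factors C f g \<longleftrightarrow> (\<exists>h\<in>homs C (Dom C f) (Dom C g). g \<bullet>\<^bsub>C\<^esub> h = f)"

lemma subobj_lattice_simps:
  "carrier (subobj_lattice C X) = monos_into C X // subobj_equiv C X"
  "A \<sqsubseteq>\<^bsub>subobj_lattice C X\<^esub> B \<longleftrightarrow> (\<exists>f\<in>A. \<exists>g\<in>B. factors C f g)"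
  by (simp_all add: subobj_lattice_def factors_def)

context category
begin

lemma monos_intoE:
  assumes "f \<in> monos_into C X"
  shows "f \<in> homs C (Dom C f) X" "mono_arr C f"
  using assms by (auto simp: monos_into_def mono_arr_def homs_def)

lemma monos_intoI: "\<lbrakk>f \<in> homs C Y X; mono_arr C f\<rbrakk> \<Longrightarrow> f \<in> monos_into C X"
  by (simp add: monos_into_def homs_def)

lemma factors_refl: "f \<in> monos_into C X \<Longrightarrow> factors C f f"
  using Idt_homs Comp_Idt homsE(4) monos_intoE(1) unfolding factors_def by metis

lemma factors_trans:
  assumes "factors C f g" "factors C g h" "h \<in> monos_into C X"
  shows "factors C f h"
proof -
  obtain u v where "u \<in> homs C (Dom C f) (Dom C g)" "g \<bullet> u = f"
    and "v \<in> homs C (Dom C g) (Dom C h)" "h \<bullet> v = g"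
    using assms(1,2) unfolding factors_def by blast
  then show ?thesis
    using Comp_assoc[OF _ _ monos_intoE(1)[OF assms(3)]] Comp_homs unfolding factors_def by metis
qed

text \<open>The two factorizations are inverse to each other because they can be compared after
  composition with a mono.\<close>

lemma subobj_equiv_iff:
  "(f, g) \<in> subobj_equiv C X \<longleftrightarrow>
     f \<in> monos_into C X \<and> g \<in> monos_into C X \<and> factors C f g \<and> factors C g f"
proof
  assume "(f, g) \<in> subobj_equiv C X"
  then obtain h where f: "f \<in> monos_into C X" and g: "g \<in> monos_into C X"
    and h: "h \<in> homs C (Dom C f) (Dom C g)" "iso_arr C h" "g \<bullet> h = f"
    by (auto simp: subobj_equiv_def)
  obtain k where k: "k \<in> homs C (Dom C g) (Dom C f)" "h \<bullet> k = Idt C (Dom C g)"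
    using h(1,2) homsE[OF h(1)] unfolding iso_arr_def by metis
  have "f \<bullet> k = g"
    using Comp_assoc[OF k(1) h(1) monos_intoE(1)[OF g]] h(3) k(2) Comp_Idt[OF monos_intoE(1)[OF g]]
    by simp
  then show "f \<in> monos_into C X \<and> g \<in> monos_into C X \<and> factors C f g \<and> factors C g f"
    using f g h k by (auto simp: factors_def)
next
  assume "f \<in> monos_into C X \<and> g \<in> monos_into C X \<and> factors C f g \<and> factors C g f"
  then obtain h k where f: "f \<in> monos_into C X" and g: "g \<in> monos_into C X"
    and h: "h \<in> homs C (Dom C f) (Dom C g)" "g \<bullet> h = f"
    and k: "k \<in> homs C (Dom C g) (Dom C f)" "f \<bullet> k = g"
    unfolding factors_def by blast
  note fm = monos_intoE[OF f] and gm = monos_intoE[OF g]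
  have "f \<bullet> (k \<bullet> h) = f \<bullet> Idt C (Dom C f)"
    using Comp_assoc[OF h(1) k(1) fm(1)] h(2) k(2) Comp_Idt[OF fm(1)] by simp
  then have kh: "k \<bullet> h = Idt C (Dom C f)"
    using mono_cancel[OF fm(2,1) Comp_homs[OF h(1) k(1)] Idt_homs] homsE(4)[OF fm(1)] by blast
  have "g \<bullet> (h \<bullet> k) = g \<bullet> Idt C (Dom C g)"
    using Comp_assoc[OF k(1) h(1) gm(1)] h(2) k(2) Comp_Idt[OF gm(1)] by simp
  then have "h \<bullet> k = Idt C (Dom C g)"
    using mono_cancel[OF gm(2,1) Comp_homs[OF k(1) h(1)] Idt_homs] homsE(4)[OF gm(1)] by blast
  then show "(f, g) \<in> subobj_equiv C X"
    using iso_arrI[OF h(1) k(1) kh] f g h unfolding subobj_equiv_def by blast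
qed

lemma equiv_subobj_equiv: "equiv (monos_into C X) (subobj_equiv C X)"
proof (rule equivI)
  show "refl_on (monos_into C X) (subobj_equiv C X)"
    using factors_refl by (auto simp: refl_on_def subobj_equiv_iff)
  show "sym (subobj_equiv C X)" by (auto simp: sym_def subobj_equiv_iff)
  show "trans (subobj_equiv C X)"
    using factors_trans unfolding trans_def subobj_equiv_iff by blast
qed (auto simp: subobj_equiv_iff)

lemma subobj_class:
  "f \<in> monos_into C X \<Longrightarrow> subobj_equiv C X `` {f} \<in> carrier (subobj_lattice C X)"
  "f \<in> monos_into C X \<Longrightarrow> f \<in> subobj_equiv C X `` {f}"
  using equiv_class_self[OF equiv_subobj_equiv]
  by (auto simp: subobj_lattice_simps intro: quotientI)

lemma subobj_nonempty: "A \<in> carrier (subobj_lattice C X) \<Longrightarrow> \<exists>f. f \<in> A"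
  using in_quotient_imp_non_empty[OF equiv_subobj_equiv] by (auto simp: subobj_lattice_simps)

lemma subobj_mono:
  "\<lbrakk>A \<in> carrier (subobj_lattice C X); f \<in> A\<rbrakk> \<Longrightarrow> f \<in> monos_into C X"
  using in_quotient_imp_subset[OF equiv_subobj_equiv] by (auto simp: subobj_lattice_simps)

lemma subobj_equivalent:
  assumes "A \<in> carrier (subobj_lattice C X)" "f \<in> A"
  shows "g \<in> A \<longleftrightarrow> g \<in> monos_into C X \<and> factors C f g \<and> factors C g f"
proof -
  have "g \<in> A \<longleftrightarrow> (f, g) \<in> subobj_equiv C X"
    using assms in_quotient_imp_in_rel[OF equiv_subobj_equiv]
      in_quotient_imp_closed[OF equiv_subobj_equiv]
    unfolding subobj_lattice_simps by blast
  then show ?thesis using subobj_mono[OF assms] by (auto simp: subobj_equiv_iff)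
qed

lemma subobj_le_iff:
  assumes A: "A \<in> carrier (subobj_lattice C X)" "f \<in> A"
    and B: "B \<in> carrier (subobj_lattice C X)" "g \<in> B"
  shows "A \<sqsubseteq>\<^bsub>subobj_lattice C X\<^esub> B \<longleftrightarrow> factors C f g"
proof
  assume "A \<sqsubseteq>\<^bsub>subobj_lattice C X\<^esub> B"
  then obtain f' g' where f': "f' \<in> A" and g': "g' \<in> B" and fg: "factors C f' g'"
    by (auto simp: subobj_lattice_simps)
  have "factors C f f'" "factors C g' g"
    using subobj_equivalent[OF A] subobj_equivalent[OF B] f' g' by blast+
  then show "factors C f g"
    using fg factors_trans subobj_mono[OF B] subobj_mono[OF B(1) g'] by blast
next
  assume "factors C f g"
  then show "A \<sqsubseteq>\<^bsub>subobj_lattice C X\<^esub> B" using A B by (auto simp: subobj_lattice_simps)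
qed

text \<open>The lattice operations are choices of a greatest or least element, so they mean
  something only once such an element exists. Here \<open>m\<close> is the evidence of existence; the meet
  need not be the class of \<open>m\<close> by definition.\<close>

lemma greatest_meet:
  assumes A: "A \<in> carrier (subobj_lattice C X)" "f \<in> A"
    and B: "B \<in> carrier (subobj_lattice C X)" "g \<in> B"
    and m: "m \<in> monos_into C X" "factors C m f" "factors C m g"
    and univ: "\<And>u. \<lbrakk>u \<in> monos_into C X; factors C u f; factors C u g\<rbrakk> \<Longrightarrow> factors C u m"
  shows "greatest (subobj_lattice C X) (A \<sqinter>\<^bsub>subobj_lattice C X\<^esub> B) (Lower (subobj_lattice C X) {A, B})"
proof -
  have "greatest (subobj_lattice C X) (subobj_equiv C X `` {m}) (Lower (subobj_lattice C X) {A, B})"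
    unfolding greatest_def
  proof (intro conjI ballI)
    show "subobj_equiv C X `` {m} \<in> Lower (subobj_lattice C X) {A, B}"
      using subobj_class[OF m(1)] subobj_le_iff[OF subobj_class[OF m(1)]] A B m(2,3)
      unfolding Lower_def by auto
    fix U assume U: "U \<in> Lower (subobj_lattice C X) {A, B}"
    then have UC: "U \<in> carrier (subobj_lattice C X)" by (simp add: Lower_def)
    then obtain u where u: "u \<in> U" using subobj_nonempty by blast
    have "factors C u f" "factors C u g"
      using subobj_le_iff[OF UC u] U A B unfolding Lower_def by auto
    then show "U \<sqsubseteq>\<^bsub>subobj_lattice C X\<^esub> subobj_equiv C X `` {m}"
      using univ subobj_mono[OF UC u] subobj_le_iff[OF UC u subobj_class[OF m(1)]] by blast
  qed (auto simp: Lower_def)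
  then show ?thesis unfolding meet_def inf_def by (rule someI)
qed

lemma least_join:
  assumes A: "A \<in> carrier (subobj_lattice C X)" "f \<in> A"
    and B: "B \<in> carrier (subobj_lattice C X)" "g \<in> B"
    and m: "m \<in> monos_into C X" "factors C f m" "factors C g m"
    and univ: "\<And>u. \<lbrakk>u \<in> monos_into C X; factors C f u; factors C g u\<rbrakk> \<Longrightarrow> factors C m u"
  shows "least (subobj_lattice C X) (A \<squnion>\<^bsub>subobj_lattice C X\<^esub> B) (Upper (subobj_lattice C X) {A, B})"
proof -
  have "least (subobj_lattice C X) (subobj_equiv C X `` {m}) (Upper (subobj_lattice C X) {A, B})"
    unfolding least_def
  proof (intro conjI ballI)
    show "subobj_equiv C X `` {m} \<in> Upper (subobj_lattice C X) {A, B}"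
      using subobj_class[OF m(1)] subobj_le_iff[OF _ _ subobj_class[OF m(1)]] A B m(2,3)
      unfolding Upper_def by auto
    fix U assume U: "U \<in> Upper (subobj_lattice C X) {A, B}"
    then have UC: "U \<in> carrier (subobj_lattice C X)" by (simp add: Upper_def)
    then obtain u where u: "u \<in> U" using subobj_nonempty by blast
    have "factors C f u" "factors C g u"
      using subobj_le_iff[OF _ _ UC u] U A B unfolding Upper_def by auto
    then show "subobj_equiv C X `` {m} \<sqsubseteq>\<^bsub>subobj_lattice C X\<^esub> U"
      using univ subobj_mono[OF UC u] subobj_le_iff[OF subobj_class[OF m(1)] UC u] by blast
  qed (auto simp: Upper_def)
  then show ?thesis unfolding join_def sup_def by (rule someI)
qed

end

context abelian_category
begin

text \<open>The intersection is the part of \<open>g\<close> that the quotient map \<open>c\<close> of \<open>f\<close> kills, that is,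
  the kernel of \<open>c \<bullet> g\<close>.\<close>

lemma intersection_exists:
  assumes f: "f \<in> monos_into C X" and g: "g \<in> monos_into C X"
  obtains m where "m \<in> monos_into C X" "factors C m f" "factors C m g"
    and "\<And>u. \<lbrakk>u \<in> monos_into C X; factors C u f; factors C u g\<rbrakk> \<Longrightarrow> factors C u m"
proof -
  note fm = monos_intoE[OF f] and gm = monos_intoE[OF g]
  obtain c where c: "is_cokernel C c f" using ex_cokernel homsE(1)[OF fm(1)] by blast
  note cD = is_cokernelD[OF c fm(1)]
  note fk = is_kernelD[OF mono_is_kernel[OF fm c] cD(1)]
  have cg: "c \<bullet> g \<in> homs C (Dom C g) (Cod C c)" using Comp_homs gm cD by blast
  obtain k where k: "is_kernel C k (c \<bullet> g)" using ex_kernel homsE(1)[OF cg] by blast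
  note kD = is_kernelD[OF k cg]
  have m: "g \<bullet> k \<in> homs C (Dom C k) X" using Comp_homs[OF kD(1) gm(1)] .
  have mm: "g \<bullet> k \<in> monos_into C X" using monos_intoI[OF m mono_comp[OF kD(1,2) gm]] .
  have dm: "Dom C (g \<bullet> k) = Dom C k" using homsE[OF m] by blast
  show ?thesis
  proof (rule that[OF mm])
    have "c \<bullet> (g \<bullet> k) = Zero C (Dom C k) (Cod C c)"
      using Comp_assoc[OF kD(1) gm(1) cD(1)] kD(3) by simp
    then show "factors C (g \<bullet> k) f" using fk(4)[OF m] dm by (simp add: factors_def)
    show "factors C (g \<bullet> k) g" using kD(1) dm unfolding factors_def by metis
    fix u assume u: "u \<in> monos_into C X" "factors C u f" "factors C u g"
    obtain v w where v: "v \<in> homs C (Dom C u) (Dom C f)" "f \<bullet> v = u"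
      and w: "w \<in> homs C (Dom C u) (Dom C g)" "g \<bullet> w = u" using u(2,3) unfolding factors_def by blast
    have "c \<bullet> g \<bullet> w = c \<bullet> f \<bullet> v"
      using Comp_assoc[OF w(1) gm(1) cD(1)] Comp_assoc[OF v(1) fm(1) cD(1)] v w by simp
    also have "\<dots> = Zero C (Dom C u) (Cod C c)"
      using cD(3) Zero_Comp[OF v(1) homsE(5)[OF cD(1)]] by simp
    finally obtain t where t: "t \<in> homs C (Dom C u) (Dom C k)" "k \<bullet> t = w" using kD(4)[OF w(1)] by blast
    then have "g \<bullet> k \<bullet> t = u" using Comp_assoc[OF t(1) kD(1) gm(1)] w by simp
    then show "factors C u (g \<bullet> k)" using t dm unfolding factors_def by metis
  qed
qed

text \<open>Divide \<open>X\<close> by \<open>f\<close> and then by the image of \<open>g\<close>; the sum is the kernel of the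
  resulting quotient map. A subobject \<open>u\<close> above both is the kernel of its cokernel \<open>v\<close>, and
  \<open>v\<close> factors through this quotient.\<close>

lemma sum_exists:
  assumes f: "f \<in> monos_into C X" and g: "g \<in> monos_into C X"
  obtains m where "m \<in> monos_into C X" "factors C f m" "factors C g m"
    and "\<And>u. \<lbrakk>u \<in> monos_into C X; factors C f u; factors C g u\<rbrakk> \<Longrightarrow> factors C m u"
proof -
  note fm = monos_intoE[OF f] and gm = monos_intoE[OF g]
  obtain c where c: "is_cokernel C c f" using ex_cokernel homsE(1)[OF fm(1)] by blast
  note cD = is_cokernelD[OF c fm(1)]
  have cg: "c \<bullet> g \<in> homs C (Dom C g) (Cod C c)" using Comp_homs gm cD by blast
  obtain d where d: "is_cokernel C d (c \<bullet> g)" using ex_cokernel homsE(1)[OF cg] by blast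
  note dD = is_cokernelD[OF d cg]
  have dc: "d \<bullet> c \<in> homs C X (Cod C d)" using Comp_homs[OF cD(1) dD(1)] .
  obtain m where m: "is_kernel C m (d \<bullet> c)" using ex_kernel homsE(1)[OF dc] by blast
  note mD = is_kernelD[OF m dc]
  show ?thesis
  proof (rule that)
    show "m \<in> monos_into C X" using monos_intoI[OF mD(1,2)] .
    have "d \<bullet> c \<bullet> f = Zero C (Dom C f) (Cod C d)"
      using Comp_assoc[OF fm(1) cD(1) dD(1)] cD(3) Comp_Zero[OF dD(1) homsE(4)[OF fm(1)]] by simp
    then show "factors C f m" using mD(4)[OF fm(1)] by (simp add: factors_def)
    have "d \<bullet> c \<bullet> g = Zero C (Dom C g) (Cod C d)"
      using Comp_assoc[OF gm(1) cD(1) dD(1)] dD(3) by simp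
    then show "factors C g m" using mD(4)[OF gm(1)] by (simp add: factors_def)
    fix u assume u: "u \<in> monos_into C X" "factors C f u" "factors C g u"
    note um = monos_intoE[OF u(1)]
    obtain p q where p: "p \<in> homs C (Dom C f) (Dom C u)" "u \<bullet> p = f"
      and q: "q \<in> homs C (Dom C g) (Dom C u)" "u \<bullet> q = g" using u(2,3) unfolding factors_def by blast
    obtain v where v: "is_cokernel C v u" using ex_cokernel homsE(1)[OF um(1)] by blast
    note vD = is_cokernelD[OF v um(1)]
    note VO = homsE(5)[OF vD(1)]
    have "v \<bullet> f = Zero C (Dom C f) (Cod C v)" and vg: "v \<bullet> g = Zero C (Dom C g) (Cod C v)"
      using Comp_assoc[OF p(1) um(1) vD(1)] Comp_assoc[OF q(1) um(1) vD(1)] p q vD(3)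
        Zero_Comp[OF p(1) VO] Zero_Comp[OF q(1) VO] by simp_all
    then obtain v' where v': "v' \<in> homs C (Cod C c) (Cod C v)" "v' \<bullet> c = v" using cD(4)[OF vD(1)] by blast
    have "v' \<bullet> (c \<bullet> g) = Zero C (Dom C g) (Cod C v)"
      using Comp_assoc[OF gm(1) cD(1) v'(1)] v'(2) vg by simp
    then obtain w where w: "w \<in> homs C (Cod C d) (Cod C v)" "w \<bullet> d = v'" using dD(4)[OF v'(1)] by blast
    have "v \<bullet> m = w \<bullet> (d \<bullet> c \<bullet> m)"
      using Comp_assoc[OF cD(1) dD(1) w(1)] Comp_assoc[OF mD(1) dc w(1)] v' w by simp
    also have "\<dots> = Zero C (Dom C m) (Cod C v)"
      using mD(3) Comp_Zero[OF w(1) homsE(4)[OF mD(1)]] by simp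
    finally show "factors C m u"
      using is_kernelD(4)[OF mono_is_kernel[OF um v] vD(1) mD(1)] by (simp add: factors_def)
  qed
qed

lemma meet_representative:
  assumes A: "A \<in> carrier (subobj_lattice C X)" "f \<in> A"
    and B: "B \<in> carrier (subobj_lattice C X)" "g \<in> B"
    and h: "h \<in> A \<sqinter>\<^bsub>subobj_lattice C X\<^esub> B"
  shows "factors C h f" "factors C h g"
    and "\<lbrakk>u \<in> monos_into C X; factors C u f; factors C u g\<rbrakk> \<Longrightarrow> factors C u h"
proof -
  let ?L = "subobj_lattice C X"
  have gr: "greatest ?L (A \<sqinter>\<^bsub>?L\<^esub> B) (Lower ?L {A, B})"
    using intersection_exists[OF subobj_mono[OF A] subobj_mono[OF B]] greatest_meet[OF A B] by metis
  then have lo: "A \<sqinter>\<^bsub>?L\<^esub> B \<in> Lower ?L {A, B}" by (simp add: greatest_def)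
  then have mc: "A \<sqinter>\<^bsub>?L\<^esub> B \<in> carrier ?L" by (simp add: Lower_def)
  show "factors C h f" "factors C h g"
    using lo A B subobj_le_iff[OF mc h] by (auto simp: Lower_def)
  assume u: "u \<in> monos_into C X" "factors C u f" "factors C u g"
  note uc = subobj_class[OF u(1)]
  have "subobj_equiv C X `` {u} \<in> Lower ?L {A, B}"
    using u(2,3) uc subobj_le_iff[OF uc] A B by (auto simp: Lower_def)
  then show "factors C u h" using gr subobj_le_iff[OF uc mc h] by (auto simp: greatest_def)
qed

lemma join_representative:
  assumes A: "A \<in> carrier (subobj_lattice C X)" "f \<in> A"
    and B: "B \<in> carrier (subobj_lattice C X)" "g \<in> B"
    and h: "h \<in> A \<squnion>\<^bsub>subobj_lattice C X\<^esub> B"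
    and u: "u \<in> monos_into C X" "factors C f u" "factors C g u"
  shows "factors C h u"
proof -
  let ?L = "subobj_lattice C X"
  have le: "least ?L (A \<squnion>\<^bsub>?L\<^esub> B) (Upper ?L {A, B})"
    using sum_exists[OF subobj_mono[OF A] subobj_mono[OF B]] least_join[OF A B] by metis
  then have mc: "A \<squnion>\<^bsub>?L\<^esub> B \<in> carrier ?L" by (simp add: least_def Upper_def)
  note uc = subobj_class[OF u(1)]
  have "subobj_equiv C X `` {u} \<in> Upper ?L {A, B}"
    using u(2,3) uc subobj_le_iff[OF _ _ uc] A B by (auto simp: Upper_def)
  then show "factors C h u" using le subobj_le_iff[OF mc h uc] by (auto simp: least_def)
qed

end

section \<open>The s-sets around an f-set\<close>

text \<open>This is \<open>N J\<close>, the largest s-set that is disjoint from \<open>J\<close> when \<open>J \<subseteq> I\<close> and \<open>r\<close> is a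
  preorder on \<open>I\<close>.\<close>

definition not_above :: "'i set \<Rightarrow> 'i rel \<Rightarrow> 'i set \<Rightarrow> 'i set" where
  "not_above I r J = {i \<in> I. \<forall>j\<in>J. (j, i) \<notin> r}"

lemma s_sets_f_sets: "J \<in> s_sets I r \<Longrightarrow> J \<in> f_sets I r"
  by (auto simp: s_sets_def f_sets_def)

lemma f_sets_subset: "J \<in> f_sets I r \<Longrightarrow> J \<subseteq> I"
  by (simp add: f_sets_def)

lemma s_sets_Int: "\<lbrakk>A \<in> s_sets I r; B \<in> s_sets I r\<rbrakk> \<Longrightarrow> A \<inter> B \<in> s_sets I r"
  by (auto simp: s_sets_def)

lemma s_sets_Un: "\<lbrakk>A \<in> s_sets I r; B \<in> s_sets I r\<rbrakk> \<Longrightarrow> A \<union> B \<in> s_sets I r"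
  by (auto simp: s_sets_def)

lemma empty_s_set: "{} \<in> s_sets I r" and whole_s_set: "I \<in> s_sets I r"
  by (auto simp: s_sets_def)

lemma s_sets_G_pair: "\<lbrakk>A \<in> s_sets I r; B \<in> s_sets I r; A \<subseteq> B\<rbrakk> \<Longrightarrow> (A, B) \<in> G_pairs I r"
  using s_sets_f_sets by (auto simp: s_sets_def G_pairs_def)

lemma G_pairsE:
  assumes "(J, K) \<in> G_pairs I r"
  shows "J \<in> f_sets I r" "K \<in> f_sets I r" "J \<subseteq> K"
  using assms by (auto simp: G_pairs_def)

lemma H_pairsE:
  assumes "(J, K) \<in> H_pairs I r"
  shows "J \<in> f_sets I r" "K \<in> f_sets I r" "K \<subseteq> J"
  using assms by (auto simp: H_pairs_def)

lemma G_pairs_trans: "\<lbrakk>(J, K) \<in> G_pairs I r; (K, L) \<in> G_pairs I r\<rbrakk> \<Longrightarrow> (J, L) \<in> G_pairs I r"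
  unfolding G_pairs_def by blast

lemma H_pairs_trans: "\<lbrakk>(J, K) \<in> H_pairs I r; (K, L) \<in> H_pairs I r\<rbrakk> \<Longrightarrow> (J, L) \<in> H_pairs I r"
  unfolding H_pairs_def by blast

lemma G_pair_diff: "(J, K) \<in> G_pairs I r \<Longrightarrow> (K, K - J) \<in> H_pairs I r"
  unfolding G_pairs_def H_pairs_def f_sets_def by blast

lemma f_sets_Int: "\<lbrakk>J \<in> f_sets I r; L \<in> f_sets I r\<rbrakk> \<Longrightarrow> J \<inter> L \<in> f_sets I r"
  unfolding f_sets_def by blast

text \<open>The pairs on the right of the exchange law between \<open>\<pi>\<close> and \<open>\<iota>\<close>.\<close>

lemma G_H_inter:
  assumes "(J, K) \<in> G_pairs I r" "(K, L) \<in> H_pairs I r"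
  shows "(J, J \<inter> L) \<in> H_pairs I r" "(J \<inter> L, L) \<in> G_pairs I r"
proof -
  have f: "J \<in> f_sets I r" "L \<in> f_sets I r" and sub: "J \<subseteq> K" "L \<subseteq> K"
    using G_pairsE[OF assms(1)] H_pairsE[OF assms(2)] by blast+
  have G: "\<forall>j\<in>J. \<forall>k\<in>K. (k, j) \<in> r \<longrightarrow> k \<in> J" using assms(1) by (simp add: G_pairs_def)
  have H: "\<forall>j\<in>K. \<forall>k\<in>L. (k, j) \<in> r \<longrightarrow> j \<in> L" using assms(2) by (simp add: H_pairs_def)
  show "(J, J \<inter> L) \<in> H_pairs I r"
    using f f_sets_Int[OF f] H sub unfolding H_pairs_def by simp blast
  show "(J \<inter> L, L) \<in> G_pairs I r"
    using f f_sets_Int[OF f] G sub unfolding G_pairs_def by simp blast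
qed

lemma not_above_antimono: "J \<subseteq> K \<Longrightarrow> not_above I r K \<subseteq> not_above I r J"
  by (auto simp: not_above_def)

locale preordered_set =
  fixes I :: "'i set" and r :: "'i rel"
  assumes preorder: "preorder_on I r"
begin

abbreviation N :: "'i set \<Rightarrow> 'i set" where "N \<equiv> not_above I r"
abbreviation M :: "'i set \<Rightarrow> 'i set" where "M J \<equiv> N J \<union> J"

lemma rel_refl: "i \<in> I \<Longrightarrow> (i, i) \<in> r"
  using preorder by (auto simp: preorder_on_def refl_on_def)

lemma rel_trans: "\<lbrakk>(i, j) \<in> r; (j, k) \<in> r\<rbrakk> \<Longrightarrow> (i, k) \<in> r"
  using preorder unfolding preorder_on_def by (blast dest: transD)

lemma N_s_set: "N J \<in> s_sets I r"
proof -
  have "i \<in> N J" if "i \<in> I" "k \<in> N J" "(i, k) \<in> r" for i k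
    using that rel_trans unfolding not_above_def by blast
  moreover have "N J \<subseteq> I" by (auto simp: not_above_def)
  ultimately show ?thesis unfolding s_sets_def by blast
qed

lemma N_disjoint: "J \<subseteq> I \<Longrightarrow> N J \<inter> J = {}"
  using rel_refl by (auto simp: not_above_def)

lemma N_whole: "N I = {}"
  using rel_refl by (auto simp: not_above_def)

text \<open>The s-set \<open>N K \<union> J\<close> has the same lower part \<open>N K\<close> as the subquotient of \<open>K\<close>, so it
  presents the object of \<open>J\<close> inside the object of \<open>K\<close>. An element below \<open>j \<in> J\<close> that is above
  \<open>k \<in> K\<close> lies in \<open>K\<close> by convexity and then in \<open>J\<close>, since \<open>J\<close> is closed downwards in \<open>K\<close>.\<close>

lemma N_Un_s_set:
  assumes "(J, K) \<in> G_pairs I r"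
  shows "N K \<union> J \<in> s_sets I r"
proof -
  have "i \<in> N K \<union> J" if ij: "i \<in> I" "j \<in> N K \<union> J" "(i, j) \<in> r" for i j
  proof (rule ccontr)
    assume i: "i \<notin> N K \<union> J"
    then obtain k where k: "k \<in> K" "(k, i) \<in> r" using ij by (auto simp: not_above_def)
    then have "(k, j) \<in> r" using rel_trans ij by blast
    then have j: "j \<in> J" using k ij by (auto simp: not_above_def)
    then have "i \<in> K" using assms k ij unfolding G_pairs_def f_sets_def by blast
    then show False using assms i j ij by (auto simp: G_pairs_def)
  qed
  moreover have "N K \<union> J \<subseteq> I" using assms unfolding G_pairs_def f_sets_def not_above_def by blast
  ultimately show ?thesis unfolding s_sets_def by blast
qed

lemma M_s_set: "J \<in> f_sets I r \<Longrightarrow> M J \<in> s_sets I r"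
  by (rule N_Un_s_set) (simp add: G_pairs_def)

lemma M_H_pair: "J \<in> f_sets I r \<Longrightarrow> (M J, J) \<in> H_pairs I r"
  using s_sets_f_sets[OF M_s_set] by (auto simp: H_pairs_def not_above_def)

text \<open>This is the maximality of \<open>M J\<close>.\<close>

lemma subset_M:
  assumes "Q \<in> s_sets I r" "(Q, J) \<in> H_pairs I r"
  shows "Q \<subseteq> M J"
  using assms by (auto simp: s_sets_def H_pairs_def not_above_def)

lemma H_pair_M_subset:
  assumes "(J, K) \<in> H_pairs I r"
  shows "M J \<subseteq> M K"
proof
  fix i assume i: "i \<in> M J"
  then have "i \<in> I" using f_sets_subset[OF H_pairsE(1)[OF assms]] by (auto simp: not_above_def)
  have "i \<in> K" if k: "k \<in> K" "(k, i) \<in> r" for k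
  proof -
    have "i \<in> J" using i k H_pairsE(3)[OF assms] by (auto simp: not_above_def)
    then show ?thesis using assms k by (auto simp: H_pairs_def)
  qed
  then show "i \<in> M K" using \<open>i \<in> I\<close> by (auto simp: not_above_def)
qed

lemma G_pair_M_subset: "(J, K) \<in> G_pairs I r \<Longrightarrow> N K \<union> J \<subseteq> M J \<inter> M K"
  using not_above_antimono[of J K] by (auto simp: G_pairs_def)

lemma G_pair_N_Un_H:
  assumes "(J, K) \<in> G_pairs I r"
  shows "(N K \<union> J, J) \<in> H_pairs I r"
proof -
  have "q \<in> J" if "q \<in> N K \<union> J" "j \<in> J" "(j, q) \<in> r" for q j
    using that G_pairsE(3)[OF assms] by (auto simp: not_above_def)
  then show ?thesis
    using s_sets_f_sets[OF N_Un_s_set[OF assms]] G_pairsE(1)[OF assms]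
    unfolding H_pairs_def by blast
qed

lemma G_pair_N_inter: "(J, K) \<in> G_pairs I r \<Longrightarrow> (N K \<union> J) \<inter> N J = N K"
  using not_above_antimono[of J K] N_disjoint[of J] f_sets_subset[of J] by (auto simp: G_pairs_def)

lemma G_pair_N_diff:
  assumes "(J, K) \<in> G_pairs I r"
  shows "M K \<inter> N (K - J) = N K \<union> J"
proof
  show "M K \<inter> N (K - J) \<subseteq> N K \<union> J"
    using N_disjoint[of "K - J"] f_sets_subset[OF G_pairsE(2)[OF assms]] by blast
  have "N K \<subseteq> N (K - J)" by (rule not_above_antimono) blast
  moreover have "J \<subseteq> N (K - J)"
    using assms f_sets_subset[OF G_pairsE(1)[OF assms]] unfolding G_pairs_def not_above_def by blast
  ultimately show "N K \<union> J \<subseteq> M K \<inter> N (K - J)" using G_pairsE(3)[OF assms] by blast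
qed

end

section \<open>The configuration of a family of subobjects\<close>

text \<open>The lattice of subobjects is replaced by representatives \<open>s A\<close>. The assumptions \<open>s_Int\<close>
  and \<open>s_Un\<close> give only the universal properties of intersection and sum; their other
  halves follow from \<open>s_le\<close>. The representative of the whole object is the identity because
  a configuration must take the value \<open>X\<close> itself at \<open>I\<close>, not just an isomorphic object.\<close>

locale subobject_family = abelian_category C + preordered_set I r
  for C :: "('o, 'm, 'z) additive_cat_scheme" (structure) and I :: "'i set" and r :: "'i rel" +
  fixes X :: 'o and s :: "'i set \<Rightarrow> 'm"
  assumes X_Obj: "X \<in> Obj C"
    and s_mono: "A \<in> s_sets I r \<Longrightarrow> s A \<in> monos_into C X"
    and s_le: "\<lbrakk>A \<in> s_sets I r; B \<in> s_sets I r; A \<subseteq> B\<rbrakk> \<Longrightarrow> factors C (s A) (s B)"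
    and s_Int: "\<lbrakk>A \<in> s_sets I r; B \<in> s_sets I r; u \<in> monos_into C X;
      factors C u (s A); factors C u (s B)\<rbrakk> \<Longrightarrow> factors C u (s (A \<inter> B))"
    and s_Un: "\<lbrakk>A \<in> s_sets I r; B \<in> s_sets I r; u \<in> monos_into C X;
      factors C (s A) u; factors C (s B) u\<rbrakk> \<Longrightarrow> factors C (s (A \<union> B)) u"
    and s_empty: "zero_object C (Dom C (s {}))"
    and s_whole: "s I = Idt C X"
begin

abbreviation d :: "'i set \<Rightarrow> 'o" where "d A \<equiv> Dom C (s A)"

lemma s_homs: "A \<in> s_sets I r \<Longrightarrow> s A \<in> homs C (d A) X"
  using monos_intoE s_mono by blast

lemma d_Obj: "A \<in> s_sets I r \<Longrightarrow> d A \<in> Obj C"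
  using homsE(4)[OF s_homs] by blast

lemma d_whole: "d I = X"
  using homsE(2)[OF Idt_homs[OF X_Obj]] s_whole by simp

definition incl :: "'i set \<Rightarrow> 'i set \<Rightarrow> 'm" where
  "incl A B = (SOME h. h \<in> homs C (d A) (d B) \<and> s B \<bullet> h = s A)"

context
  fixes A B assumes A: "A \<in> s_sets I r" and B: "B \<in> s_sets I r" and AB: "A \<subseteq> B"
begin

lemma incl_props: "incl A B \<in> homs C (d A) (d B) \<and> s B \<bullet> incl A B = s A"
  unfolding incl_def by (rule someI_ex) (use s_le[OF A B AB] in \<open>auto simp: factors_def\<close>)

lemmas incl_homs = incl_props[THEN conjunct1] and incl_s = incl_props[THEN conjunct2]

lemma incl_eqI: "\<lbrakk>h \<in> homs C (d A) (d B); s B \<bullet> h = s A\<rbrakk> \<Longrightarrow> h = incl A B"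
  using mono_cancel[OF monos_intoE(2)[OF s_mono[OF B]] s_homs[OF B]] incl_homs incl_s by metis

lemma incl_mono: "mono_arr C (incl A B)"
  using mono_right_factor[OF incl_homs s_homs[OF B]] incl_s monos_intoE(2)[OF s_mono[OF A]] by simp

end

lemma incl_comp:
  assumes A: "A \<in> s_sets I r" and B: "B \<in> s_sets I r" and D: "D \<in> s_sets I r" and "A \<subseteq> B" "B \<subseteq> D"
  shows "incl B D \<bullet> incl A B = incl A D"
proof (rule incl_eqI[OF A D])
  note AB = incl_homs[OF A B \<open>A \<subseteq> B\<close>] and BD = incl_homs[OF B D \<open>B \<subseteq> D\<close>]
  show "incl B D \<bullet> incl A B \<in> homs C (d A) (d D)" using Comp_homs[OF AB BD] .
  show "s D \<bullet> (incl B D \<bullet> incl A B) = s A"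
    using Comp_assoc[OF AB BD s_homs[OF D]] incl_s assms by simp
qed (use assms in auto)

lemma incl_Idt: "A \<in> s_sets I r \<Longrightarrow> incl A A = Idt C (d A)"
  using incl_eqI[OF _ _ subset_refl Idt_homs[OF d_Obj]] Comp_Idt[OF s_homs] by metis

text \<open>For \<open>J = I\<close> the denominator \<open>N I\<close> is empty, so the identity of \<open>X\<close> is one possible
  cokernel. Choosing it makes the object of \<open>I\<close> equal to \<open>X\<close>.\<close>

definition quo :: "'i set \<Rightarrow> 'm" where
  "quo J = (if J = I then Idt C X else SOME c. is_cokernel C c (incl (N J) (M J)))"

definition obj :: "'i set \<Rightarrow> 'o" where "obj J = Cod C (quo J)"

lemma M_whole: "M I = I"
  using N_whole by simp

lemma obj_whole: "obj I = X"
  using homsE(3)[OF Idt_homs[OF X_Obj]] by (simp add: obj_def quo_def)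

context
  fixes J assumes J: "J \<in> f_sets I r"
begin

lemma N_M_homs: "incl (N J) (M J) \<in> homs C (d (N J)) (d (M J))"
  using incl_homs[OF N_s_set M_s_set[OF J]] by simp

lemma quo_cokernel: "is_cokernel C (quo J) (incl (N J) (M J))"
proof (cases "J = I")
  case True
  note Ih = Idt_homs[OF X_Obj]
  have z: "incl {} I \<in> homs C (d {}) X"
    using incl_homs[OF empty_s_set whole_s_set] d_whole by simp
  have "is_cokernel C (Idt C X) (incl {} I)"
  proof (rule is_cokernelI[OF z Ih])
    show "epi_arr C (Idt C X)" by (rule epi_arrI[OF Ih]) (auto simp: Comp_Idt)
    show "Idt C X \<bullet> incl {} I = Zero C (d {}) X"
      using Idt_Comp[OF z] zero_object_from[OF s_empty z] by simp
  qed (use Comp_Idt in blast)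
  then show ?thesis using True N_whole by (simp add: quo_def)
next
  case False
  then show ?thesis using someI_ex[OF ex_cokernel[OF homsE(1)[OF N_M_homs]]] by (simp add: quo_def)
qed

lemmas quo_props = is_cokernelD(1-3)[OF quo_cokernel N_M_homs, folded obj_def]

lemma obj_Obj: "obj J \<in> Obj C"
  using homsE(5)[OF quo_props(1)] .

lemma quo_kernel: "is_kernel C (incl (N J) (M J)) (quo J)"
  using mono_is_kernel[OF N_M_homs incl_mono[OF N_s_set M_s_set[OF J]] quo_cokernel] by simp

end

text \<open>The map from \<open>d Q\<close> to the subquotient of \<open>J\<close>, by restriction of the quotient map of
  \<open>d (M J)\<close>. It is meaningful for \<open>Q \<subseteq> M J\<close>.\<close>

definition res :: "'i set \<Rightarrow> 'i set \<Rightarrow> 'm" where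
  "res Q J = quo J \<bullet> incl Q (M J)"

context
  fixes J Q assumes J: "J \<in> f_sets I r" and Q: "Q \<in> s_sets I r" and sub: "Q \<subseteq> M J"
begin

lemma res_homs: "res Q J \<in> homs C (d Q) (obj J)"
  unfolding res_def using Comp_homs[OF incl_homs[OF Q M_s_set[OF J] sub] quo_props(1)[OF J]] .

lemma res_incl:
  assumes "P \<in> s_sets I r" "P \<subseteq> Q"
  shows "res Q J \<bullet> incl P Q = res P J"
  using Comp_assoc[OF incl_homs[OF assms(1) Q assms(2)] incl_homs[OF Q M_s_set[OF J] sub]
      quo_props(1)[OF J]] incl_comp[OF assms(1) Q M_s_set[OF J] assms(2) sub]
  by (simp add: res_def)

lemma res_zero:
  assumes "Q \<subseteq> N J"
  shows "res Q J = Zero C (d Q) (obj J)"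
proof -
  note QN = incl_homs[OF Q N_s_set assms] and NM = N_M_homs[OF J]
  have "res Q J = quo J \<bullet> (incl (N J) (M J) \<bullet> incl Q (N J))"
    using incl_comp[OF Q N_s_set M_s_set[OF J] assms] by (simp add: res_def)
  also have "\<dots> = Zero C (d Q) (obj J)"
    using Comp_assoc[OF QN NM quo_props(1)[OF J]] quo_props(3)[OF J]
      Zero_Comp[OF QN obj_Obj[OF J]] by simp
  finally show ?thesis .
qed

end

context
  fixes J Q assumes J: "J \<in> f_sets I r" and Q: "Q \<in> s_sets I r" and sub: "Q \<subseteq> M J"
begin

text \<open>This is where intersections enter: the kernel of \<open>res Q J\<close> is a subobject of \<open>X\<close> below
  both \<open>d Q\<close> and \<open>d (N J)\<close>, hence below \<open>d (Q \<inter> N J)\<close>.\<close>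

lemma res_kernel: "is_kernel C (incl (Q \<inter> N J) Q) (res Q J)"
proof (rule is_kernelI[OF res_homs[OF J Q sub]])
  note QN = s_sets_Int[OF Q N_s_set[of J]] and Ms = M_s_set[OF J]
  show i: "incl (Q \<inter> N J) Q \<in> homs C (d (Q \<inter> N J)) (d Q)" using incl_homs[OF QN Q] by simp
  show "mono_arr C (incl (Q \<inter> N J) Q)" using incl_mono[OF QN Q] by simp
  obtain k where k: "is_kernel C k (res Q J)" using ex_kernel homsE(1)[OF res_homs[OF J Q sub]] by blast
  note kD = is_kernelD[OF k res_homs[OF J Q sub]] and QM = incl_homs[OF Q Ms sub]
  \<comment> \<open>the hypothesis on intersections speaks of subobjects of \<open>X\<close>, so \<open>k\<close> is composed with \<open>s Q\<close>\<close>
  have sk: "s Q \<bullet> k \<in> homs C (Dom C k) X" using Comp_homs[OF kD(1) s_homs[OF Q]] .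
  have skm: "s Q \<bullet> k \<in> monos_into C X"
    using monos_intoI[OF sk mono_comp[OF kD(1,2) monos_intoE[OF s_mono[OF Q]]]] .
  have dk: "Dom C (s Q \<bullet> k) = Dom C k" using homsE(2)[OF sk] .
  have "quo J \<bullet> (incl Q (M J) \<bullet> k) = Zero C (Dom C k) (obj J)"
    using Comp_assoc[OF kD(1) QM quo_props(1)[OF J]] kD(3) by (simp add: res_def)
  then obtain t where t: "t \<in> homs C (Dom C k) (d (N J))" "incl (N J) (M J) \<bullet> t = incl Q (M J) \<bullet> k"
    using is_kernelD(4)[OF quo_kernel[OF J] quo_props(1)[OF J] Comp_homs[OF kD(1) QM]]
      homsE(2)[OF N_M_homs[OF J]] by auto
  have "s (N J) \<bullet> t = s (M J) \<bullet> (incl (N J) (M J) \<bullet> t)"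
    using Comp_assoc[OF t(1) N_M_homs[OF J] s_homs[OF Ms]] incl_s[OF N_s_set Ms] by simp
  also have "\<dots> = s Q \<bullet> k"
    using t(2) Comp_assoc[OF kD(1) QM s_homs[OF Ms]] incl_s[OF Q Ms sub] by simp
  finally have "factors C (s Q \<bullet> k) (s (N J))" using t(1) dk unfolding factors_def by auto
  moreover have "factors C (s Q \<bullet> k) (s Q)" using kD(1) dk unfolding factors_def by auto
  ultimately have "factors C (s Q \<bullet> k) (s (Q \<inter> N J))" using s_Int[OF Q N_s_set skm] by blast
  then obtain v where v: "v \<in> homs C (Dom C k) (d (Q \<inter> N J))" "s (Q \<inter> N J) \<bullet> v = s Q \<bullet> k"
    unfolding factors_def dk by blast
  have "s Q \<bullet> (incl (Q \<inter> N J) Q \<bullet> v) = s Q \<bullet> k"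
    using Comp_assoc[OF v(1) i s_homs[OF Q]] incl_s[OF QN Q] v(2) by simp
  then have iv: "incl (Q \<inter> N J) Q \<bullet> v = k"
    using mono_cancel[OF monos_intoE(2)[OF s_mono[OF Q]] s_homs[OF Q] Comp_homs[OF v(1) i] kD(1)] by blast
  show "res Q J \<bullet> incl (Q \<inter> N J) Q = Zero C (d (Q \<inter> N J)) (obj J)"
    using res_incl[OF J Q sub QN] res_zero[OF J QN] sub by auto
  fix W g assume g: "g \<in> homs C W (d Q)" "res Q J \<bullet> g = Zero C W (obj J)"
  then obtain h where h: "h \<in> homs C W (Dom C k)" "k \<bullet> h = g" using kD(4) by blast
  then show "\<exists>h\<in>homs C W (d (Q \<inter> N J)). incl (Q \<inter> N J) Q \<bullet> h = g"
    using Comp_assoc[OF h(1) v(1) i] iv Comp_homs[OF h(1) v(1)] by auto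
qed

text \<open>This is where sums enter: if \<open>g\<close> kills \<open>res Q J\<close>, the kernel of \<open>g\<close> on \<open>d (M J)\<close> contains
  \<open>d Q\<close> and \<open>d (N J)\<close>, hence all of \<open>d (M J)\<close>.\<close>

lemma res_epi:
  assumes "J \<subseteq> Q"
  shows "epi_arr C (res Q J)"
proof (rule epi_arrI_zero[OF res_homs[OF J Q sub]])
  fix W g assume g: "g \<in> homs C (obj J) W" "g \<bullet> res Q J = Zero C (d Q) W"
  note Ms = M_s_set[OF J] note sM = s_homs[OF Ms] and qJ = quo_props[OF J] and NM = N_M_homs[OF J]
  note QM = incl_homs[OF Q Ms sub] and gq = Comp_homs[OF qJ(1) g(1)] and WO = homsE(5)[OF g(1)]
  obtain k where k: "is_kernel C k (g \<bullet> quo J)" using ex_kernel homsE(1)[OF gq] by blast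
  note kD = is_kernelD[OF k gq]
  have sk: "s (M J) \<bullet> k \<in> homs C (Dom C k) X" using Comp_homs[OF kD(1) sM] .
  have skm: "s (M J) \<bullet> k \<in> monos_into C X"
    using monos_intoI[OF sk mono_comp[OF kD(1,2) monos_intoE[OF s_mono[OF Ms]]]] .
  have dk: "Dom C (s (M J) \<bullet> k) = Dom C k" using homsE(2)[OF sk] .
  have below: "factors C (s P) (s (M J) \<bullet> k)"
    if P: "P \<in> s_sets I r" "P \<subseteq> M J" and zero: "g \<bullet> quo J \<bullet> incl P (M J) = Zero C (d P) W" for P
  proof -
    note PM = incl_homs[OF P(1) Ms P(2)]
    obtain t where t: "t \<in> homs C (d P) (Dom C k)" "k \<bullet> t = incl P (M J)"
      using kD(4)[OF PM zero] by blast
    have "s (M J) \<bullet> k \<bullet> t = s P"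
      using Comp_assoc[OF t(1) kD(1) sM] t(2) incl_s[OF P(1) Ms P(2)] by simp
    then show ?thesis using t(1) dk unfolding factors_def by auto
  qed
  have "factors C (s Q) (s (M J) \<bullet> k)"
    using below[OF Q sub] Comp_assoc[OF QM qJ(1) g(1)] g(2) by (simp add: res_def)
  moreover have "factors C (s (N J)) (s (M J) \<bullet> k)"
    using below[OF N_s_set] Comp_assoc[OF NM qJ(1) g(1)] qJ(3)
      Comp_Zero[OF g(1) d_Obj[OF N_s_set]] by simp
  moreover have "Q \<union> N J = M J" using sub assms by blast
  ultimately have "factors C (s (M J)) (s (M J) \<bullet> k)" using s_Un[OF Q N_s_set skm, of J] by simp
  \<comment> \<open>the kernel k is everything, so it has a section and g vanishes\<close>
  then obtain v where v: "v \<in> homs C (d (M J)) (Dom C k)" "s (M J) \<bullet> k \<bullet> v = s (M J)"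
    unfolding factors_def dk by blast
  have "s (M J) \<bullet> (k \<bullet> v) = s (M J) \<bullet> Idt C (d (M J))"
    using Comp_assoc[OF v(1) kD(1) sM] v(2) Comp_Idt[OF sM] by simp
  then have kv: "k \<bullet> v = Idt C (d (M J))"
    using mono_cancel[OF monos_intoE(2)[OF s_mono[OF Ms]] sM Comp_homs[OF v(1) kD(1)]]
      Idt_homs[OF d_Obj[OF Ms]] by blast
  have "g \<bullet> quo J = g \<bullet> quo J \<bullet> k \<bullet> v"
    using Comp_assoc[OF v(1) kD(1) gq] kv Comp_Idt[OF gq] by simp
  also have "\<dots> = Zero C (d (M J)) W" using kD(3) Zero_Comp[OF v(1) WO] by simp
  also have "\<dots> = Zero C (obj J) W \<bullet> quo J" using Zero_Comp[OF qJ(1) WO] by simp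
  finally show "g = Zero C (obj J) W"
    using epi_cancel[OF qJ(2,1) g(1) Zero_homs[OF obj_Obj[OF J] WO]] by blast
qed

end

lemma res_M: "J \<in> f_sets I r \<Longrightarrow> res (M J) J = quo J"
  using incl_Idt[OF M_s_set] Comp_Idt[OF quo_props(1)] by (simp add: res_def)

definition inj_map :: "'i set \<Rightarrow> 'i set \<Rightarrow> 'm" where
  "inj_map J K = (SOME f. f \<in> homs C (obj J) (obj K) \<and>
     f \<bullet> res (N K \<union> J) J = res (N K \<union> J) K)"

definition proj_map :: "'i set \<Rightarrow> 'i set \<Rightarrow> 'm" where
  "proj_map J K = (SOME f. f \<in> homs C (obj J) (obj K) \<and> f \<bullet> res (M J) J = res (M J) K)"

text \<open>Since \<open>J \<subseteq> Q\<close>, the map \<open>res Q J\<close> is epi and thus the cokernel of its kernel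
  \<open>d (Q \<inter> N J)\<close>, which \<open>res Q K\<close> kills by the last hypothesis.\<close>

lemma induced_map:
  assumes J: "J \<in> f_sets I r" and K: "K \<in> f_sets I r"
    and Q: "Q \<in> s_sets I r" "J \<subseteq> Q" "Q \<subseteq> M J" "Q \<subseteq> M K" and N: "Q \<inter> N J \<subseteq> N K"
  shows "\<exists>f. f \<in> homs C (obj J) (obj K) \<and> f \<bullet> res Q J = res Q K"
proof -
  note QN = s_sets_Int[OF Q(1) N_s_set[of J]]
  have i: "incl (Q \<inter> N J) Q \<in> homs C (d (Q \<inter> N J)) (d Q)" using incl_homs[OF QN Q(1)] by simp
  note rJ = res_homs[OF J Q(1,3)] and rK = res_homs[OF K Q(1,4)]
  have c: "is_cokernel C (res Q J) (incl (Q \<inter> N J) Q)"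
    using epi_is_cokernel[OF rJ res_epi[OF J Q(1,3,2)] res_kernel[OF J Q(1,3)]] .
  have "res Q K \<bullet> incl (Q \<inter> N J) Q = Zero C (d (Q \<inter> N J)) (obj K)"
    using res_incl[OF K Q(1,4) QN] res_zero[OF K QN _ N] Q(4) by auto
  then show ?thesis using is_cokernelD(4)[OF c i rK] homsE(3)[OF rJ] by auto
qed

lemma inj_map_props:
  assumes G: "(J, K) \<in> G_pairs I r"
  shows "inj_map J K \<in> homs C (obj J) (obj K) \<and>
     inj_map J K \<bullet> res (N K \<union> J) J = res (N K \<union> J) K"
  unfolding inj_map_def
  by (rule someI_ex, rule induced_map)
    (use G_pairsE[OF G] N_Un_s_set[OF G] G_pair_M_subset[OF G] G_pair_N_inter[OF G] in auto)

lemmas inj_map_homs = inj_map_props[THEN conjunct1]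

lemma inj_map_res:
  assumes G: "(J, K) \<in> G_pairs I r" and Q: "Q \<in> s_sets I r" "Q \<subseteq> N K \<union> J"
  shows "inj_map J K \<bullet> res Q J = res Q K"
proof -
  note GE = G_pairsE[OF G] and NKJ = N_Un_s_set[OF G]
  have sub: "N K \<union> J \<subseteq> M J" "N K \<union> J \<subseteq> M K" using G_pair_M_subset[OF G] by auto
  have "inj_map J K \<bullet> (res (N K \<union> J) J \<bullet> incl Q (N K \<union> J)) = res (N K \<union> J) K \<bullet> incl Q (N K \<union> J)"
    using Comp_assoc[OF incl_homs[OF Q(1) NKJ Q(2)] res_homs[OF GE(1) NKJ sub(1)] inj_map_homs[OF G]]
      inj_map_props[OF G] by simp
  then show ?thesis using res_incl[OF GE(1) NKJ sub(1) Q] res_incl[OF GE(2) NKJ sub(2) Q] by simp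
qed

lemma proj_map_props:
  assumes H: "(J, K) \<in> H_pairs I r"
  shows "proj_map J K \<in> homs C (obj J) (obj K) \<and> proj_map J K \<bullet> res (M J) J = res (M J) K"
  unfolding proj_map_def
  by (rule someI_ex, rule induced_map)
    (use H_pairsE[OF H] M_s_set H_pair_M_subset[OF H] not_above_antimono[OF H_pairsE(3)[OF H]] in auto)

lemmas proj_map_homs = proj_map_props[THEN conjunct1]

lemma proj_map_res:
  assumes H: "(J, K) \<in> H_pairs I r" and Q: "Q \<in> s_sets I r" "Q \<subseteq> M J"
  shows "proj_map J K \<bullet> res Q J = res Q K"
proof -
  note HE = H_pairsE[OF H] note MJ = M_s_set[OF HE(1)] and sub = H_pair_M_subset[OF H]
  have "proj_map J K \<bullet> (res (M J) J \<bullet> incl Q (M J)) = res (M J) K \<bullet> incl Q (M J)"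
    using Comp_assoc[OF incl_homs[OF Q(1) MJ Q(2)] res_homs[OF HE(1) MJ] proj_map_homs[OF H]]
      proj_map_props[OF H] by simp
  then show ?thesis using res_incl[OF HE(1) MJ _ Q] res_incl[OF HE(2) MJ sub Q] by simp
qed

lemma res_cancel:
  assumes "J \<in> f_sets I r" "Q \<in> s_sets I r" "J \<subseteq> Q" "Q \<subseteq> M J"
    and "f \<in> homs C (obj J) Y" "g \<in> homs C (obj J) Y" "f \<bullet> res Q J = g \<bullet> res Q J"
  shows "f = g"
  using epi_cancel[OF res_epi res_homs] assms by metis

lemma proj_map_epi:
  assumes H: "(J, K) \<in> H_pairs I r"
  shows "epi_arr C (proj_map J K)"
proof -
  note HE = H_pairsE[OF H] note MJ = M_s_set[OF HE(1)]
  have "epi_arr C (res (M J) K)"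
    using res_epi[OF HE(2) MJ H_pair_M_subset[OF H]] HE(3) by blast
  then show ?thesis
    using epi_left_factor[OF res_homs[OF HE(1) MJ] proj_map_homs[OF H]] proj_map_props[OF H] by simp
qed

text \<open>On \<open>Q = N K \<union> J\<close> both \<open>res Q J\<close> and \<open>res Q K\<close> have kernel \<open>d (N K)\<close>.\<close>

lemma inj_map_mono:
  assumes G: "(J, K) \<in> G_pairs I r"
  shows "mono_arr C (inj_map J K)"
proof -
  note GE = G_pairsE[OF G] and Q = N_Un_s_set[OF G]
  have sub: "N K \<union> J \<subseteq> M J" "N K \<union> J \<subseteq> M K" using G_pair_M_subset[OF G] by auto
  have NK: "(N K \<union> J) \<inter> N K = N K" by blast
  note i = incl_homs[OF N_s_set[of K] Q Un_upper1]
  show ?thesis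
  proof (rule mono_of_kernels[OF res_homs[OF GE(1) Q sub(1)] res_epi[OF GE(1) Q sub(1)]
        inj_map_homs[OF G] _ i])
    show "is_kernel C (incl (N K) (N K \<union> J)) (inj_map J K \<bullet> res (N K \<union> J) J)"
      using res_kernel[OF GE(2) Q sub(2)] inj_map_props[OF G] NK by simp
    show "res (N K \<union> J) J \<bullet> incl (N K) (N K \<union> J) = Zero C (d (N K)) (obj J)"
      using res_incl[OF GE(1) Q sub(1) N_s_set Un_upper1]
        res_zero[OF GE(1) N_s_set _ not_above_antimono[OF GE(3)]] sub(1) by simp
  qed simp
qed

text \<open>Here \<open>M {} = N {} = I\<close>, so the quotient map is both epi and zero.\<close>

lemma obj_empty: "zero_object C (obj {})"
proof (rule zero_objectI)
  have e: "{} \<in> f_sets I r" by (simp add: f_sets_def)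
  show "obj {} \<in> Obj C" using obj_Obj[OF e] .
  have "res (M {}) {} = Zero C (d (M {})) (obj {})"
    by (rule res_zero[OF e M_s_set[OF e]]) auto
  then have z: "quo {} = Zero C (d (M {})) (obj {})" using res_M[OF e] by simp
  note q = quo_props[OF e] note O = homsE(5)[OF q(1)]
  have "Idt C (obj {}) \<bullet> quo {} = Zero C (obj {}) (obj {}) \<bullet> quo {}"
    using Idt_Comp[OF q(1)] Zero_Comp[OF q(1) O] z by simp
  then show "Idt C (obj {}) = Zero C (obj {}) (obj {})"
    using epi_cancel[OF q(2,1) Idt_homs[OF O] Zero_homs[OF O O]] by blast
qed

text \<open>The kernel of \<open>d (M K)\<close> over the object of \<open>K - J\<close> belongs to the s-set
  \<open>M K \<inter> N (K - J) = N K \<union> J\<close>, whose image in the object of \<open>K\<close> is the object of \<open>J\<close>.\<close>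

lemma short_exact_maps:
  assumes G: "(J, K) \<in> G_pairs I r"
  shows "short_exact C (inj_map J K) (proj_map K (K - J))"
proof -
  note GE = G_pairsE[OF G] and H = G_pair_diff[OF G]
  note HE = H_pairsE[OF H] and NKJ = N_Un_s_set[OF G] and p = proj_map_homs[OF H]
  note MK = M_s_set[OF GE(2)] and q = quo_props[OF GE(2)]
  have sub: "N K \<union> J \<subseteq> M J" "N K \<union> J \<subseteq> M K" using G_pair_M_subset[OF G] by auto
  have "is_cokernel C (proj_map K (K - J)) (inj_map J K)"
  proof (rule cokernel_of_induced[OF q(1,2) p proj_map_epi[OF H]])
    have "proj_map K (K - J) \<bullet> quo K = res (M K) (K - J)"
      using proj_map_props[OF H] res_M[OF GE(2)] by simp
    then show "is_kernel C (incl (N K \<union> J) (M K)) (proj_map K (K - J) \<bullet> quo K)"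
      using res_kernel[OF HE(2) MK H_pair_M_subset[OF H]] G_pair_N_diff[OF G] by simp
    show "incl (N K \<union> J) (M K) \<in> homs C (d (N K \<union> J)) (d (M K))" using incl_homs[OF NKJ MK sub(2)] .
    show "res (N K \<union> J) J \<in> homs C (d (N K \<union> J)) (obj J)" using res_homs[OF GE(1) NKJ sub(1)] .
    show "epi_arr C (res (N K \<union> J) J)" using res_epi[OF GE(1) NKJ sub(1)] by simp
    show "inj_map J K \<in> homs C (obj J) (obj K)" using inj_map_homs[OF G] .
    show "quo K \<bullet> incl (N K \<union> J) (M K) = inj_map J K \<bullet> res (N K \<union> J) J"
      using inj_map_props[OF G] by (simp add: res_def)
  qed
  then show ?thesis using short_exactI[OF inj_map_homs[OF G] inj_map_mono[OF G]] by blast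
qed

lemma inj_map_Idt:
  assumes J: "J \<in> f_sets I r"
  shows "inj_map J J = Idt C (obj J)"
proof (rule res_cancel[OF J M_s_set[OF J] _ subset_refl])
  have G: "(J, J) \<in> G_pairs I r" using J by (simp add: G_pairs_def)
  show "inj_map J J \<in> homs C (obj J) (obj J)" using inj_map_homs[OF G] .
  show "Idt C (obj J) \<in> homs C (obj J) (obj J)" using Idt_homs[OF obj_Obj[OF J]] .
  show "inj_map J J \<bullet> res (M J) J = Idt C (obj J) \<bullet> res (M J) J"
    using inj_map_props[OF G] Idt_Comp[OF res_homs[OF J M_s_set[OF J] subset_refl]] by simp
qed simp

lemma proj_map_Idt:
  assumes J: "J \<in> f_sets I r"
  shows "proj_map J J = Idt C (obj J)"
proof (rule res_cancel[OF J M_s_set[OF J] _ subset_refl])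
  have H: "(J, J) \<in> H_pairs I r" using J by (simp add: H_pairs_def)
  show "proj_map J J \<in> homs C (obj J) (obj J)" using proj_map_homs[OF H] .
  show "Idt C (obj J) \<in> homs C (obj J) (obj J)" using Idt_homs[OF obj_Obj[OF J]] .
  show "proj_map J J \<bullet> res (M J) J = Idt C (obj J) \<bullet> res (M J) J"
    using proj_map_props[OF H] Idt_Comp[OF res_homs[OF J M_s_set[OF J] subset_refl]] by simp
qed simp

lemma inj_map_comp:
  assumes G1: "(J, K) \<in> G_pairs I r" and G2: "(K, L) \<in> G_pairs I r"
  shows "inj_map J L = inj_map K L \<bullet> inj_map J K"
proof -
  note G = G_pairs_trans[OF G1 G2]
  note J = G_pairsE(1)[OF G] and Q = N_Un_s_set[OF G]
  have sub: "N L \<union> J \<subseteq> M J" "N L \<union> J \<subseteq> N K \<union> J" "N L \<union> J \<subseteq> N L \<union> K"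
    using G_pair_M_subset[OF G] not_above_antimono[OF G_pairsE(3)[OF G2]] G_pairsE(3)[OF G1] by auto
  show ?thesis
  proof (rule res_cancel[OF J Q _ sub(1)])
    show "inj_map J L \<in> homs C (obj J) (obj L)" using inj_map_homs[OF G] .
    show "inj_map K L \<bullet> inj_map J K \<in> homs C (obj J) (obj L)"
      using Comp_homs[OF inj_map_homs[OF G1] inj_map_homs[OF G2]] .
    show "inj_map J L \<bullet> res (N L \<union> J) J = inj_map K L \<bullet> inj_map J K \<bullet> res (N L \<union> J) J"
      using Comp_assoc[OF res_homs[OF J Q sub(1)] inj_map_homs[OF G1] inj_map_homs[OF G2]]
        inj_map_res[OF G Q] inj_map_res[OF G1 Q sub(2)] inj_map_res[OF G2 Q sub(3)] by simp
  qed simp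
qed

lemma proj_map_comp:
  assumes H1: "(J, K) \<in> H_pairs I r" and H2: "(K, L) \<in> H_pairs I r"
  shows "proj_map J L = proj_map K L \<bullet> proj_map J K"
proof -
  note H = H_pairs_trans[OF H1 H2]
  note J = H_pairsE(1)[OF H] note Q = M_s_set[OF J]
  show ?thesis
  proof (rule res_cancel[OF J Q _ subset_refl])
    show "proj_map J L \<in> homs C (obj J) (obj L)" using proj_map_homs[OF H] .
    show "proj_map K L \<bullet> proj_map J K \<in> homs C (obj J) (obj L)"
      using Comp_homs[OF proj_map_homs[OF H1] proj_map_homs[OF H2]] .
    show "proj_map J L \<bullet> res (M J) J = proj_map K L \<bullet> proj_map J K \<bullet> res (M J) J"
      using Comp_assoc[OF res_homs[OF J Q] proj_map_homs[OF H1] proj_map_homs[OF H2]]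
        proj_map_res[OF H Q] proj_map_res[OF H1 Q] proj_map_res[OF H2 Q H_pair_M_subset[OF H1]] by simp
  qed simp
qed

text \<open>Compare on \<open>Q = N K \<union> J\<close>, on which both composites restrict to \<open>res Q L\<close>. The path through
  \<open>J \<inter> L\<close> requires \<open>Q \<subseteq> N L \<union> (J \<inter> L)\<close>: an element of \<open>J\<close> above some element of \<open>L\<close> is in \<open>L\<close>.\<close>

lemma proj_inj_map:
  assumes G: "(J, K) \<in> G_pairs I r" and H: "(K, L) \<in> H_pairs I r"
  shows "proj_map K L \<bullet> inj_map J K = inj_map (J \<inter> L) L \<bullet> proj_map J (J \<inter> L)"
proof -
  note H' = G_H_inter(1)[OF G H] and G' = G_H_inter(2)[OF G H]
  note J = G_pairsE(1)[OF G] and Q = N_Un_s_set[OF G]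
  have sub: "N K \<union> J \<subseteq> M J" "N K \<union> J \<subseteq> M K" using G_pair_M_subset[OF G] by auto
  have "J \<subseteq> N L \<union> (J \<inter> L)"
    using G H f_sets_subset[OF J] by (fastforce simp: G_pairs_def H_pairs_def not_above_def)
  then have subL: "N K \<union> J \<subseteq> N L \<union> (J \<inter> L)"
    using not_above_antimono[OF H_pairsE(3)[OF H]] by blast
  show ?thesis
  proof (rule res_cancel[OF J Q _ sub(1)])
    show "proj_map K L \<bullet> inj_map J K \<in> homs C (obj J) (obj L)"
      using Comp_homs[OF inj_map_homs[OF G] proj_map_homs[OF H]] .
    show "inj_map (J \<inter> L) L \<bullet> proj_map J (J \<inter> L) \<in> homs C (obj J) (obj L)"
      using Comp_homs[OF proj_map_homs[OF H'] inj_map_homs[OF G']] .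
    show "proj_map K L \<bullet> inj_map J K \<bullet> res (N K \<union> J) J =
        inj_map (J \<inter> L) L \<bullet> proj_map J (J \<inter> L) \<bullet> res (N K \<union> J) J"
      using Comp_assoc[OF res_homs[OF J Q sub(1)] inj_map_homs[OF G] proj_map_homs[OF H]]
        Comp_assoc[OF res_homs[OF J Q sub(1)] proj_map_homs[OF H'] inj_map_homs[OF G']]
        inj_map_res[OF G Q] proj_map_res[OF H Q sub(2)] proj_map_res[OF H' Q sub(1)]
        inj_map_res[OF G' Q subL] by simp
  qed simp
qed

definition quotient_config :: "('i, 'o, 'm) config" where
  "quotient_config = \<lparr>csig = obj, cinj = inj_map, cproj = proj_map\<rparr>"

lemma quotient_configuration: "configuration C I r quotient_config"
  unfolding quotient_config_def
  by (unfold_locales; unfold config.simps; fact obj_Obj obj_empty inj_map_homs inj_map_mono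
      inj_map_Idt proj_map_homs proj_map_epi proj_map_Idt short_exact_maps inj_map_comp
      proj_map_comp proj_inj_map)

text \<open>For an s-set \<open>J\<close> the map \<open>res J J\<close> is epi, and it is mono because \<open>inj_map J I\<close> takes it
  to the mono \<open>s J\<close>. So the subquotient of \<open>J\<close> is isomorphic to \<open>d J\<close> over \<open>X\<close>.\<close>

lemma inj_map_represents:
  assumes J: "J \<in> s_sets I r"
  shows "inj_map J I \<in> monos_into C X" "factors C (s J) (inj_map J I)" "factors C (inj_map J I) (s J)"
proof -
  have G: "(J, I) \<in> G_pairs I r"
    using s_sets_G_pair[OF J whole_s_set] J by (simp add: s_sets_def)
  note f = s_sets_f_sets[OF J]
  note i = inj_map_homs[OF G, unfolded obj_whole]
  note r = res_homs[OF f J Un_upper2]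
  have comp: "inj_map J I \<bullet> res J J = s J"
  proof -
    have "inj_map J I \<bullet> res J J = res J I" using inj_map_res[OF G J] by simp
    also have "\<dots> = incl J I"
      using Idt_Comp[OF incl_homs[OF J whole_s_set]] J d_whole
      by (simp add: res_def quo_def M_whole s_sets_def)
    also have "\<dots> = s J"
      using incl_s[OF J whole_s_set] incl_homs[OF J whole_s_set] J d_whole s_whole
      by (simp add: s_sets_def Idt_Comp)
    finally show ?thesis .
  qed
  have "mono_arr C (res J J)"
    using mono_right_factor[OF r i] comp monos_intoE(2)[OF s_mono[OF J]] by simp
  then obtain t where t: "t \<in> homs C (obj J) (d J)" "res J J \<bullet> t = Idt C (obj J)"
    using mono_epi_iso[OF r _ res_epi[OF f J]] by blast
  have "s J \<bullet> t = inj_map J I"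
    using Comp_assoc[OF t(1) r i] comp t(2) Comp_Idt[OF i] by simp
  then show "factors C (inj_map J I) (s J)" using t(1) homsE(2)[OF i] by (auto simp: factors_def)
  show "factors C (s J) (inj_map J I)" using r comp homsE(2)[OF i] by (auto simp: factors_def)
  show "inj_map J I \<in> monos_into C X" using monos_intoI[OF i inj_map_mono[OF G]] .
qed

end

section \<open>Uniqueness of the configuration\<close>

lemma (in preadditive_category) config_morphism_comp:
  assumes S: "configuration C I r S" and T: "configuration C I r T" and U: "configuration C I r U"
    and a: "config_morphism C I r S T \<alpha>" and b: "config_morphism C I r T U \<beta>"
  shows "config_morphism C I r S U (\<lambda>J\<in>f_sets I r. \<beta> J \<bullet> \<alpha> J)"
proof -
  have ah: "\<alpha> J \<in> homs C (\<sigma>\<^bsub>S\<^esub> J) (\<sigma>\<^bsub>T\<^esub> J)" and bh: "\<beta> J \<in> homs C (\<sigma>\<^bsub>T\<^esub> J) (\<sigma>\<^bsub>U\<^esub> J)"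
    if "J \<in> f_sets I r" for J
    using a b that by (auto simp: config_morphism_def)
  have comm: "\<beta> K \<bullet> \<alpha> K \<bullet> f = h \<bullet> (\<beta> J \<bullet> \<alpha> J)"
    if "J \<in> f_sets I r" "K \<in> f_sets I r"
      and f: "f \<in> homs C (\<sigma>\<^bsub>S\<^esub> J) (\<sigma>\<^bsub>S\<^esub> K)" and g: "g \<in> homs C (\<sigma>\<^bsub>T\<^esub> J) (\<sigma>\<^bsub>T\<^esub> K)"
      and h: "h \<in> homs C (\<sigma>\<^bsub>U\<^esub> J) (\<sigma>\<^bsub>U\<^esub> K)"
      and "\<alpha> K \<bullet> f = g \<bullet> \<alpha> J" "\<beta> K \<bullet> g = h \<bullet> \<beta> J" for J K f g h
    using that Comp_assoc[OF f ah bh] Comp_assoc[OF ah g bh] Comp_assoc[OF ah bh h] by metis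
  show ?thesis
    unfolding config_morphism_def
  proof (intro conjI ballI; clarify?)
    show "(\<lambda>J\<in>f_sets I r. \<beta> J \<bullet> \<alpha> J) \<in> (\<Pi>\<^sub>E J\<in>f_sets I r. homs C (\<sigma>\<^bsub>S\<^esub> J) (\<sigma>\<^bsub>U\<^esub> J))"
      using Comp_homs[OF ah bh] by auto
  next
    fix J K assume G: "(J, K) \<in> G_pairs I r"
    note f = G_pairsE[OF G]
    have "\<alpha> K \<bullet> \<iota>\<^bsub>S\<^esub> J K = \<iota>\<^bsub>T\<^esub> J K \<bullet> \<alpha> J" "\<beta> K \<bullet> \<iota>\<^bsub>T\<^esub> J K = \<iota>\<^bsub>U\<^esub> J K \<bullet> \<beta> J"
      using a b G unfolding config_morphism_def by auto
    from comm[OF f(1,2) S[THEN configuration.iota_homs, OF G] T[THEN configuration.iota_homs, OF G]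
        U[THEN configuration.iota_homs, OF G] this]
    show "(\<lambda>J\<in>f_sets I r. \<beta> J \<bullet> \<alpha> J) K \<bullet> \<iota>\<^bsub>S\<^esub> J K = \<iota>\<^bsub>U\<^esub> J K \<bullet> (\<lambda>J\<in>f_sets I r. \<beta> J \<bullet> \<alpha> J) J"
      using f by simp
  next
    fix J K assume H: "(J, K) \<in> H_pairs I r"
    note f = H_pairsE[OF H]
    have "\<alpha> K \<bullet> \<pi>\<^bsub>S\<^esub> J K = \<pi>\<^bsub>T\<^esub> J K \<bullet> \<alpha> J" "\<beta> K \<bullet> \<pi>\<^bsub>T\<^esub> J K = \<pi>\<^bsub>U\<^esub> J K \<bullet> \<beta> J"
      using a b H unfolding config_morphism_def by auto
    from comm[OF f(1,2) S[THEN configuration.pi_homs, OF H] T[THEN configuration.pi_homs, OF H]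
        U[THEN configuration.pi_homs, OF H] this]
    show "(\<lambda>J\<in>f_sets I r. \<beta> J \<bullet> \<alpha> J) K \<bullet> \<pi>\<^bsub>S\<^esub> J K = \<pi>\<^bsub>U\<^esub> J K \<bullet> (\<lambda>J\<in>f_sets I r. \<beta> J \<bullet> \<alpha> J) J"
      using f by simp
  qed
qed

lemma (in preadditive_category) config_morphism_Idt:
  assumes S: "configuration C I r S"
  shows "config_morphism C I r S S (\<lambda>J\<in>f_sets I r. Idt C (\<sigma>\<^bsub>S\<^esub> J))"
  using Idt_homs[OF configuration.sigma_Obj[OF S]]
    Comp_Idt[OF configuration.iota_homs[OF S]] Idt_Comp[OF configuration.iota_homs[OF S]]
    Comp_Idt[OF configuration.pi_homs[OF S]] Idt_Comp[OF configuration.pi_homs[OF S]]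
  by (auto simp: config_morphism_def dest: G_pairsE H_pairsE)

locale configuration_pair = abelian_category C + preordered_set I r
  for C :: "('o, 'm, 'z) additive_cat_scheme" (structure) and I :: "'i set" and r :: "'i rel" +
  fixes X :: 'o and S T :: "('i, 'o, 'm) config"
  assumes S: "configuration C I r S" and T: "configuration C I r T"
    and S_whole: "\<sigma>\<^bsub>S\<^esub> I = X" and T_whole: "\<sigma>\<^bsub>T\<^esub> I = X"
begin

sublocale S: configuration C I r S using S .
sublocale T: configuration C I r T using T .

lemma s_set_G_whole: "J \<in> s_sets I r \<Longrightarrow> (J, I) \<in> G_pairs I r"
  by (intro s_sets_G_pair whole_s_set f_sets_subset s_sets_f_sets)

lemma whole_f_set: "I \<in> f_sets I r"
  using s_sets_f_sets[OF whole_s_set] .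

text \<open>Monomorphisms into the value at \<open>I\<close> determine the components at s-sets, and these
  determine the component at \<open>J\<close> through the epimorphism from \<open>M J\<close>.\<close>

lemma morphism_determined:
  assumes a: "config_morphism C I r S T \<alpha>" and b: "config_morphism C I r S T \<beta>" and eq: "\<alpha> I = \<beta> I"
  shows "\<alpha> = \<beta>"
proof -
  have ah: "\<alpha> J \<in> homs C (\<sigma>\<^bsub>S\<^esub> J) (\<sigma>\<^bsub>T\<^esub> J)" and bh: "\<beta> J \<in> homs C (\<sigma>\<^bsub>S\<^esub> J) (\<sigma>\<^bsub>T\<^esub> J)"
    if "J \<in> f_sets I r" for J
    using a b that by (auto simp: config_morphism_def)
  have s: "\<alpha> J = \<beta> J" if J: "J \<in> s_sets I r" for J
  proof -
    note G = s_set_G_whole[OF J] and f = s_sets_f_sets[OF J]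
    have "\<iota>\<^bsub>T\<^esub> J I \<bullet> \<alpha> J = \<alpha> I \<bullet> \<iota>\<^bsub>S\<^esub> J I" "\<iota>\<^bsub>T\<^esub> J I \<bullet> \<beta> J = \<beta> I \<bullet> \<iota>\<^bsub>S\<^esub> J I"
      using a b G unfolding config_morphism_def by auto
    then show ?thesis
      using mono_cancel[OF T.iota_mono[OF G] T.iota_homs[OF G] ah[OF f] bh[OF f]] eq by simp
  qed
  have "\<alpha> J = \<beta> J" if J: "J \<in> f_sets I r" for J
  proof -
    note H = M_H_pair[OF J]
    have "\<alpha> J \<bullet> \<pi>\<^bsub>S\<^esub> (M J) J = \<pi>\<^bsub>T\<^esub> (M J) J \<bullet> \<alpha> (M J)" "\<beta> J \<bullet> \<pi>\<^bsub>S\<^esub> (M J) J = \<pi>\<^bsub>T\<^esub> (M J) J \<bullet> \<beta> (M J)"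
      using a b H unfolding config_morphism_def by auto
    then show ?thesis
      using epi_cancel[OF S.pi_epi[OF H] S.pi_homs[OF H] ah[OF J] bh[OF J]] s[OF M_s_set[OF J]] by simp
  qed
  then show ?thesis using a b unfolding config_morphism_def by (blast intro: PiE_ext)
qed

end

text \<open>The exchange law recovers every epimorphism from an s-set to \<open>J\<close> from the one on the
  largest such s-set.\<close>

lemma (in preadditive_category) pi_restrict:
  assumes "preordered_set I r" and S: "configuration C I r S"
    and Q: "Q \<in> s_sets I r" and H: "(Q, J) \<in> H_pairs I r"
  shows "\<pi>\<^bsub>S\<^esub> (not_above I r J \<union> J) J \<bullet> \<iota>\<^bsub>S\<^esub> Q (not_above I r J \<union> J) = \<pi>\<^bsub>S\<^esub> Q J"
proof -
  interpret preordered_set I r by fact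
  interpret S: configuration C I r S by fact
  note J = H_pairsE(2)[OF H]
  have "Q \<inter> J = J" using H_pairsE(3)[OF H] by blast
  then show ?thesis
    using S.pi_iota[OF s_sets_G_pair[OF Q M_s_set[OF J] subset_M[OF Q H]] M_H_pair[OF J]]
      S.iota_Idt[OF J] Idt_Comp[OF S.pi_homs[OF H]] by simp
qed

text \<open>The exchange law determines \<open>\<iota> J K\<close>, after composition with an epimorphism, by maps that
  start at s-sets.\<close>

lemma (in preordered_set) pi_iota_restrict:
  assumes "configuration C I r S" and G: "(J, K) \<in> G_pairs I r"
  shows "\<pi>\<^bsub>S\<^esub> (M K) K \<bullet>\<^bsub>C\<^esub> \<iota>\<^bsub>S\<^esub> (N K \<union> J) (M K) = \<iota>\<^bsub>S\<^esub> J K \<bullet>\<^bsub>C\<^esub> \<pi>\<^bsub>S\<^esub> (N K \<union> J) J"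
proof -
  note f = G_pairsE[OF G]
  have "(N K \<union> J, M K) \<in> G_pairs I r"
    using s_sets_G_pair[OF N_Un_s_set[OF G] M_s_set[OF f(2)]] f(3) by blast
  moreover have "(N K \<union> J) \<inter> K = J" using f N_disjoint[OF f_sets_subset[OF f(2)]] by blast
  ultimately show ?thesis using configuration.pi_iota[OF assms(1) _ M_H_pair[OF f(2)]] by metis
qed

locale comparable_configurations = configuration_pair C I r X S T
  for C :: "('o, 'm, 'z) additive_cat_scheme" (structure) and I :: "'i set" and r :: "'i rel"
    and X :: 'o and S T :: "('i, 'o, 'm) config" +
  assumes same_subobjects: "J \<in> s_sets I r \<Longrightarrow> factors C (\<iota>\<^bsub>S\<^esub> J I) (\<iota>\<^bsub>T\<^esub> J I)"
begin

text \<open>The component of the canonical isomorphism at an s-set: the map between two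
  representatives of one subobject of \<open>X\<close>.\<close>

definition on_s_set :: "'i set \<Rightarrow> 'm" where
  "on_s_set J = (SOME h. h \<in> homs C (\<sigma>\<^bsub>S\<^esub> J) (\<sigma>\<^bsub>T\<^esub> J) \<and> \<iota>\<^bsub>T\<^esub> J I \<bullet> h = \<iota>\<^bsub>S\<^esub> J I)"

lemma on_s_set:
  assumes J: "J \<in> s_sets I r"
  shows "on_s_set J \<in> homs C (\<sigma>\<^bsub>S\<^esub> J) (\<sigma>\<^bsub>T\<^esub> J) \<and> \<iota>\<^bsub>T\<^esub> J I \<bullet> on_s_set J = \<iota>\<^bsub>S\<^esub> J I"
  unfolding on_s_set_def
  by (rule someI_ex)
    (use same_subobjects[OF J] homsE(2)[OF S.iota_homs[OF s_set_G_whole[OF J]]]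
      homsE(2)[OF T.iota_homs[OF s_set_G_whole[OF J]]] in \<open>auto simp: factors_def\<close>)

lemmas on_s_set_homs = on_s_set[THEN conjunct1]

lemma on_s_set_whole: "on_s_set I = Idt C X"
  using on_s_set[OF whole_s_set] T.iota_Idt[OF whole_f_set] S.iota_Idt[OF whole_f_set]
    S_whole T_whole Idt_Comp by metis

lemma on_s_set_iota:
  assumes A: "A \<in> s_sets I r" and B: "B \<in> s_sets I r" and "A \<subseteq> B"
  shows "on_s_set B \<bullet> \<iota>\<^bsub>S\<^esub> A B = \<iota>\<^bsub>T\<^esub> A B \<bullet> on_s_set A"
proof (rule mono_cancel)
  note G = s_sets_G_pair[OF A B \<open>A \<subseteq> B\<close>] and GB = s_set_G_whole[OF B]
  note SA = S.iota_homs[OF G] and TA = T.iota_homs[OF G] and TB = T.iota_homs[OF GB]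
  show "mono_arr C (\<iota>\<^bsub>T\<^esub> B I)" using T.iota_mono[OF GB] .
  show "\<iota>\<^bsub>T\<^esub> B I \<in> homs C (\<sigma>\<^bsub>T\<^esub> B) (\<sigma>\<^bsub>T\<^esub> I)" using TB .
  show "on_s_set B \<bullet> \<iota>\<^bsub>S\<^esub> A B \<in> homs C (\<sigma>\<^bsub>S\<^esub> A) (\<sigma>\<^bsub>T\<^esub> B)" using Comp_homs[OF SA on_s_set_homs[OF B]] .
  show "\<iota>\<^bsub>T\<^esub> A B \<bullet> on_s_set A \<in> homs C (\<sigma>\<^bsub>S\<^esub> A) (\<sigma>\<^bsub>T\<^esub> B)" using Comp_homs[OF on_s_set_homs[OF A] TA] .
  have "\<iota>\<^bsub>T\<^esub> B I \<bullet> (on_s_set B \<bullet> \<iota>\<^bsub>S\<^esub> A B) = \<iota>\<^bsub>S\<^esub> A I"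
    using Comp_assoc[OF SA on_s_set_homs[OF B] TB] on_s_set[OF B] S.iota_comp[OF G GB] by simp
  also have "\<dots> = \<iota>\<^bsub>T\<^esub> B I \<bullet> (\<iota>\<^bsub>T\<^esub> A B \<bullet> on_s_set A)"
    using Comp_assoc[OF on_s_set_homs[OF A] TA TB] on_s_set[OF A] T.iota_comp[OF G GB] by simp
  finally show "\<iota>\<^bsub>T\<^esub> B I \<bullet> (on_s_set B \<bullet> \<iota>\<^bsub>S\<^esub> A B) = \<iota>\<^bsub>T\<^esub> B I \<bullet> (\<iota>\<^bsub>T\<^esub> A B \<bullet> on_s_set A)" .
qed

text \<open>The object at \<open>J\<close> is the cokernel of \<open>\<iota> (N J) (M J)\<close>, and \<open>on_s_set\<close> is natural for this map.\<close>

lemma pi_on_s_set_factors: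
  assumes J: "J \<in> f_sets I r"
  shows "\<exists>h\<in>homs C (\<sigma>\<^bsub>S\<^esub> J) (\<sigma>\<^bsub>T\<^esub> J). h \<bullet> \<pi>\<^bsub>S\<^esub> (M J) J = \<pi>\<^bsub>T\<^esub> (M J) J \<bullet> on_s_set (M J)"
proof -
  note Ms = M_s_set[OF J] and H = M_H_pair[OF J]
  have G: "(N J, M J) \<in> G_pairs I r" using s_sets_G_pair[OF N_s_set Ms] by blast
  have MN: "M J - N J = J" using N_disjoint[OF f_sets_subset[OF J]] by blast
  note SN = S.iota_homs[OF G] and TN = T.iota_homs[OF G] and Sp = S.pi_homs[OF H] and Tp = T.pi_homs[OF H]
  note aM = on_s_set_homs[OF Ms] and aN = on_s_set_homs[OF N_s_set]
  have c: "is_cokernel C (\<pi>\<^bsub>S\<^esub> (M J) J) (\<iota>\<^bsub>S\<^esub> (N J) (M J))"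
    using short_exact_cokernel[OF _ SN Sp S.pi_epi[OF H]] S.exact[OF G] MN by simp
  have ct: "is_cokernel C (\<pi>\<^bsub>T\<^esub> (M J) J) (\<iota>\<^bsub>T\<^esub> (N J) (M J))"
    using short_exact_cokernel[OF _ TN Tp T.pi_epi[OF H]] T.exact[OF G] MN by simp
  have "\<pi>\<^bsub>T\<^esub> (M J) J \<bullet> on_s_set (M J) \<bullet> \<iota>\<^bsub>S\<^esub> (N J) (M J)
      = \<pi>\<^bsub>T\<^esub> (M J) J \<bullet> (\<iota>\<^bsub>T\<^esub> (N J) (M J) \<bullet> on_s_set (N J))"
    using Comp_assoc[OF SN aM Tp] on_s_set_iota[OF N_s_set Ms] by simp
  also have "\<dots> = Zero C (\<sigma>\<^bsub>S\<^esub> (N J)) (\<sigma>\<^bsub>T\<^esub> J)"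
    using Comp_assoc[OF aN TN Tp] is_cokernelD(3)[OF ct TN] homsE(3)[OF Tp]
      Zero_Comp[OF aN T.sigma_Obj[OF J]] by simp
  finally show ?thesis
    using is_cokernelD(4)[OF c SN Comp_homs[OF aM Tp]] homsE(3)[OF Sp] by auto
qed

text \<open>The squares for \<open>\<iota>\<close> and \<open>\<pi>\<close> are checked after composition with an epimorphism that
  starts at an s-set; this reduces them to the naturality of \<open>on_s_set\<close>.\<close>

lemma ex_morphism:
  "\<exists>\<alpha>. config_morphism C I r S T \<alpha> \<and> \<alpha> I = Idt C X"
proof -
  obtain \<alpha> where ah: "\<And>J. J \<in> f_sets I r \<Longrightarrow> \<alpha> J \<in> homs C (\<sigma>\<^bsub>S\<^esub> J) (\<sigma>\<^bsub>T\<^esub> J)"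
    and ap: "\<And>J. J \<in> f_sets I r \<Longrightarrow> \<alpha> J \<bullet> \<pi>\<^bsub>S\<^esub> (M J) J = \<pi>\<^bsub>T\<^esub> (M J) J \<bullet> on_s_set (M J)"
    using pi_on_s_set_factors by metis
  have iota: "\<alpha> K \<bullet> \<iota>\<^bsub>S\<^esub> J K \<bullet> \<pi>\<^bsub>S\<^esub> (N K \<union> J) J = \<iota>\<^bsub>T\<^esub> J K \<bullet> \<pi>\<^bsub>T\<^esub> (N K \<union> J) J \<bullet> on_s_set (N K \<union> J)"
    if G: "(J, K) \<in> G_pairs I r" and H: "(N K \<union> J, J) \<in> H_pairs I r" for J K
  proof -
    note f = G_pairsE[OF G]
    note Q = N_Un_s_set[OF G] and Ms = M_s_set[OF f(2)] and HM = M_H_pair[OF f(2)]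
    have sub: "N K \<union> J \<subseteq> M K" using f(3) by blast
    note GQ = s_sets_G_pair[OF Q Ms sub]
    note aQ = on_s_set_homs[OF Q] and aM = on_s_set_homs[OF Ms]
    have "\<alpha> K \<bullet> \<iota>\<^bsub>S\<^esub> J K \<bullet> \<pi>\<^bsub>S\<^esub> (N K \<union> J) J = \<alpha> K \<bullet> (\<pi>\<^bsub>S\<^esub> (M K) K \<bullet> \<iota>\<^bsub>S\<^esub> (N K \<union> J) (M K))"
      using Comp_assoc[OF S.pi_homs[OF H] S.iota_homs[OF G] ah[OF f(2)]] pi_iota_restrict[OF S G] by simp
    also have "\<dots> = \<pi>\<^bsub>T\<^esub> (M K) K \<bullet> (on_s_set (M K) \<bullet> \<iota>\<^bsub>S\<^esub> (N K \<union> J) (M K))"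
      using Comp_assoc[OF S.iota_homs[OF GQ] S.pi_homs[OF HM] ah[OF f(2)]] ap[OF f(2)]
        Comp_assoc[OF S.iota_homs[OF GQ] aM T.pi_homs[OF HM]] by simp
    also have "\<dots> = \<pi>\<^bsub>T\<^esub> (M K) K \<bullet> \<iota>\<^bsub>T\<^esub> (N K \<union> J) (M K) \<bullet> on_s_set (N K \<union> J)"
      using on_s_set_iota[OF Q Ms sub] Comp_assoc[OF aQ T.iota_homs[OF GQ] T.pi_homs[OF HM]] by simp
    finally show ?thesis using pi_iota_restrict[OF T G] by simp
  qed
  have pi: "\<alpha> J \<bullet> \<pi>\<^bsub>S\<^esub> Q J = \<pi>\<^bsub>T\<^esub> Q J \<bullet> on_s_set Q"
    if Q: "Q \<in> s_sets I r" and H: "(Q, J) \<in> H_pairs I r" for Q J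
  proof -
    note J = H_pairsE(2)[OF H] and sub = subset_M[OF Q H]
    note Ms = M_s_set[OF J] and HM = M_H_pair[OF J]
    note GQ = s_sets_G_pair[OF Q Ms sub]
    note aQ = on_s_set_homs[OF Q] and aM = on_s_set_homs[OF Ms]
    have "\<alpha> J \<bullet> \<pi>\<^bsub>S\<^esub> Q J = \<pi>\<^bsub>T\<^esub> (M J) J \<bullet> (on_s_set (M J) \<bullet> \<iota>\<^bsub>S\<^esub> Q (M J))"
      using Comp_assoc[OF S.iota_homs[OF GQ] S.pi_homs[OF HM] ah[OF J]] ap[OF J]
        Comp_assoc[OF S.iota_homs[OF GQ] aM T.pi_homs[OF HM]] pi_restrict[OF preordered_set_axioms S Q H] by simp
    also have "\<dots> = \<pi>\<^bsub>T\<^esub> Q J \<bullet> on_s_set Q"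
      using on_s_set_iota[OF Q Ms sub] Comp_assoc[OF aQ T.iota_homs[OF GQ] T.pi_homs[OF HM]]
        pi_restrict[OF preordered_set_axioms T Q H] by simp
    finally show ?thesis .
  qed
  define \<alpha>' where "\<alpha>' = restrict \<alpha> (f_sets I r)"
  have "config_morphism C I r S T \<alpha>'"
    unfolding config_morphism_def
  proof (intro conjI ballI; clarify?)
    show "\<alpha>' \<in> (\<Pi>\<^sub>E J\<in>f_sets I r. homs C (\<sigma>\<^bsub>S\<^esub> J) (\<sigma>\<^bsub>T\<^esub> J))" using ah by (auto simp: \<alpha>'_def)
  next
    fix J K assume G: "(J, K) \<in> G_pairs I r"
    note f = G_pairsE[OF G] and H = G_pair_N_Un_H[OF G] and Q = N_Un_s_set[OF G]
    have "\<alpha> K \<bullet> \<iota>\<^bsub>S\<^esub> J K \<bullet> \<pi>\<^bsub>S\<^esub> (N K \<union> J) J = \<iota>\<^bsub>T\<^esub> J K \<bullet> \<alpha> J \<bullet> \<pi>\<^bsub>S\<^esub> (N K \<union> J) J"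
      using iota[OF G H] pi[OF Q H] Comp_assoc[OF S.pi_homs[OF H] ah[OF f(1)] T.iota_homs[OF G]]
        Comp_assoc[OF on_s_set_homs[OF N_Un_s_set[OF G]] T.pi_homs[OF H] T.iota_homs[OF G]] by simp
    then have "\<alpha> K \<bullet> \<iota>\<^bsub>S\<^esub> J K = \<iota>\<^bsub>T\<^esub> J K \<bullet> \<alpha> J"
      using epi_cancel[OF S.pi_epi[OF H] S.pi_homs[OF H] Comp_homs[OF S.iota_homs[OF G] ah[OF f(2)]]
          Comp_homs[OF ah[OF f(1)] T.iota_homs[OF G]]] by blast
    then show "\<alpha>' K \<bullet> \<iota>\<^bsub>S\<^esub> J K = \<iota>\<^bsub>T\<^esub> J K \<bullet> \<alpha>' J" using f by (simp add: \<alpha>'_def)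
  next
    fix J K assume H: "(J, K) \<in> H_pairs I r"
    note f = H_pairsE[OF H] note M = M_s_set[OF f(1)] and HM = M_H_pair[OF f(1)]
    have "\<alpha> K \<bullet> \<pi>\<^bsub>S\<^esub> (M J) K = \<pi>\<^bsub>T\<^esub> (M J) K \<bullet> on_s_set (M J)"
      using pi[OF M H_pairs_trans[OF HM H]] .
    then have "\<alpha> K \<bullet> \<pi>\<^bsub>S\<^esub> J K \<bullet> \<pi>\<^bsub>S\<^esub> (M J) J = \<pi>\<^bsub>T\<^esub> J K \<bullet> \<alpha> J \<bullet> \<pi>\<^bsub>S\<^esub> (M J) J"
      using Comp_assoc[OF S.pi_homs[OF HM] S.pi_homs[OF H] ah[OF f(2)]] S.pi_comp[OF HM H]
        Comp_assoc[OF S.pi_homs[OF HM] ah[OF f(1)] T.pi_homs[OF H]] T.pi_comp[OF HM H] ap[OF f(1)]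
        Comp_assoc[OF on_s_set_homs[OF M] T.pi_homs[OF HM] T.pi_homs[OF H]] by simp
    then have "\<alpha> K \<bullet> \<pi>\<^bsub>S\<^esub> J K = \<pi>\<^bsub>T\<^esub> J K \<bullet> \<alpha> J"
      using epi_cancel[OF S.pi_epi[OF HM] S.pi_homs[OF HM] Comp_homs[OF S.pi_homs[OF H] ah[OF f(2)]]
          Comp_homs[OF ah[OF f(1)] T.pi_homs[OF H]]] by blast
    then show "\<alpha>' K \<bullet> \<pi>\<^bsub>S\<^esub> J K = \<pi>\<^bsub>T\<^esub> J K \<bullet> \<alpha>' J" using f by (simp add: \<alpha>'_def)
  qed
  moreover have "\<alpha>' I = Idt C X"
  proof -
    have "(I, I) \<in> H_pairs I r" using whole_f_set by (simp add: H_pairs_def)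
    then have "\<alpha> I = on_s_set I"
      using pi[OF whole_s_set, of I] S.pi_Idt[OF whole_f_set] T.pi_Idt[OF whole_f_set]
        Comp_Idt[OF ah[OF whole_f_set]] Idt_Comp[OF on_s_set_homs[OF whole_s_set]] by simp
    then show ?thesis using on_s_set_whole whole_f_set by (simp add: \<alpha>'_def)
  qed
  ultimately show ?thesis by blast
qed

end

text \<open>The composites of the morphisms in the two directions are endomorphisms that fix the
  value at \<open>I\<close>, as the identity does, so they are the identity.\<close>

lemma (in abelian_category) ex_unique_isomorphism:
  assumes ST: "comparable_configurations C I r X S T" and TS: "comparable_configurations C I r X T S"
  shows "\<exists>!\<alpha>. config_isomorphism C I r S T \<alpha> \<and> \<alpha> I = Idt C X"
proof -
  interpret ST: comparable_configurations C I r X S T by fact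
  interpret TS: comparable_configurations C I r X T S by fact
  have X: "X \<in> Obj C" using ST.S.sigma_Obj[OF ST.whole_f_set] ST.S_whole by simp
  have inverse: "\<beta> J \<bullet> \<alpha> J = Idt C (\<sigma>\<^bsub>U\<^esub> J)"
    if U: "configuration C I r U" "\<sigma>\<^bsub>U\<^esub> I = X" and V: "configuration C I r V"
      and a: "config_morphism C I r U V \<alpha>" "\<alpha> I = Idt C X"
      and b: "config_morphism C I r V U \<beta>" "\<beta> I = Idt C X" and J: "J \<in> f_sets I r" for U V \<alpha> \<beta> J
  proof -
    interpret UU: configuration_pair C I r X U U
      by (intro configuration_pair.intro configuration_pair_axioms.intro
          abelian_category_axioms ST.preordered_set_axioms U)
    have "(\<lambda>J\<in>f_sets I r. \<beta> J \<bullet> \<alpha> J) = (\<lambda>J\<in>f_sets I r. Idt C (\<sigma>\<^bsub>U\<^esub> J))"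
    proof (rule UU.morphism_determined)
      show "config_morphism C I r U U (\<lambda>J\<in>f_sets I r. \<beta> J \<bullet> \<alpha> J)"
        by (rule config_morphism_comp[OF U(1) V U(1) a(1) b(1)])
      show "config_morphism C I r U U (\<lambda>J\<in>f_sets I r. Idt C (\<sigma>\<^bsub>U\<^esub> J))"
        by (rule config_morphism_Idt[OF U(1)])
      show "(\<lambda>J\<in>f_sets I r. \<beta> J \<bullet> \<alpha> J) I = (\<lambda>J\<in>f_sets I r. Idt C (\<sigma>\<^bsub>U\<^esub> J)) I"
        using a(2) b(2) U(2) UU.whole_f_set Comp_Idt[OF Idt_homs[OF X]] by simp
    qed
    from fun_cong[OF this, of J] show ?thesis using J by simp
  qed
  obtain \<alpha> where a: "config_morphism C I r S T \<alpha>" "\<alpha> I = Idt C X" using ST.ex_morphism by blast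
  obtain \<beta> where b: "config_morphism C I r T S \<beta>" "\<beta> I = Idt C X" using TS.ex_morphism by blast
  have "iso_arr C (\<alpha> J)" if J: "J \<in> f_sets I r" for J
  proof (rule iso_arrI)
    show "\<alpha> J \<in> homs C (\<sigma>\<^bsub>S\<^esub> J) (\<sigma>\<^bsub>T\<^esub> J)" "\<beta> J \<in> homs C (\<sigma>\<^bsub>T\<^esub> J) (\<sigma>\<^bsub>S\<^esub> J)"
      using a(1) b(1) J by (auto simp: config_morphism_def)
    show "\<beta> J \<bullet> \<alpha> J = Idt C (\<sigma>\<^bsub>S\<^esub> J)" by (rule inverse[OF ST.S ST.S_whole ST.T a b J])
    show "\<alpha> J \<bullet> \<beta> J = Idt C (\<sigma>\<^bsub>T\<^esub> J)" by (rule inverse[OF ST.T ST.T_whole ST.S b a J])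
  qed
  then have "config_isomorphism C I r S T \<alpha>" using a(1) by (simp add: config_isomorphism_def)
  moreover have "\<gamma> = \<alpha>" if "config_isomorphism C I r S T \<gamma>" "\<gamma> I = Idt C X" for \<gamma>
    using ST.morphism_determined[of \<gamma> \<alpha>] that a by (simp add: config_isomorphism_def)
  ultimately show ?thesis using a(2) by blast
qed

theorem theorem4p2:
  fixes C :: "('o, 'm, 'z) additive_cat_scheme"
    and I :: "'i set" and r :: "'i rel"
    and X :: 'o and Sub :: "'i set \<Rightarrow> 'm set"
  assumes "finite I" and "partial_order_on I r"
    and "abelian_category C" and "X \<in> Obj C"
    and "\<And>J. J \<in> s_sets I r \<Longrightarrow> Sub J \<in> carrier (subobj_lattice C X)"
    and "Sub {} = zero_subobj C X"
    and "Sub I = whole_subobj C X"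
    and "\<And>A B. \<lbrakk>A \<in> s_sets I r; B \<in> s_sets I r\<rbrakk> \<Longrightarrow>
      Sub A \<sqinter>\<^bsub>subobj_lattice C X\<^esub> Sub B = Sub (A \<inter> B)"
    and "\<And>A B. \<lbrakk>A \<in> s_sets I r; B \<in> s_sets I r\<rbrakk> \<Longrightarrow>
      Sub A \<squnion>\<^bsub>subobj_lattice C X\<^esub> Sub B = Sub (A \<union> B)"
  shows "(\<exists>S :: ('i, 'o, 'm) config. config_of_subobjs C I r X Sub S) \<and>
    (\<forall>S T :: ('i, 'o, 'm) config.
       config_of_subobjs C I r X Sub S \<and> config_of_subobjs C I r X Sub T \<longrightarrow>
       (\<exists>!\<alpha>. config_isomorphism C I r S T \<alpha> \<and> \<alpha> I = Idt C X))"
proof -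
  interpret abelian_category C by fact
  note X = assms(4) and Sub = assms(5) and meet = assms(8) and join = assms(9)
  interpret preordered_set I r
    by unfold_locales (use assms(2) in \<open>simp add: partial_order_on_def\<close>)
  define s where "s J = (if J = I then Idt C X else SOME f. f \<in> Sub J)" for J
  have sI: "s I = Idt C X" by (simp add: s_def)
  have "Idt C X \<in> Sub I"
    using subobj_class(2)[OF monos_intoI[OF Idt_homs[OF X] mono_Idt[OF X]]]
    by (simp add: assms(7) whole_subobj_def)
  then have s: "s J \<in> Sub J" if "J \<in> s_sets I r" for J
    using someI_ex[OF subobj_nonempty[OF Sub[OF that]]] by (simp add: s_def)
  interpret F: subobject_family C I r X s
  proof unfold_locales
    show "X \<in> Obj C" "s I = Idt C X" by fact+
    show "zero_object C (Dom C (s {}))" using s[OF empty_s_set] by (simp add: assms(6) zero_subobj_def)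
    show "s A \<in> monos_into C X" if "A \<in> s_sets I r" for A using subobj_mono[OF Sub s] that by blast
    fix A B assume A: "A \<in> s_sets I r" and B: "B \<in> s_sets I r"
    note mr = meet_representative[OF Sub[OF A] s[OF A] Sub[OF B] s[OF B], unfolded meet[OF A B]]
    note jr = join_representative[OF Sub[OF A] s[OF A] Sub[OF B] s[OF B], unfolded join[OF A B]]
    show "factors C (s A) (s B)" if "A \<subseteq> B"
    proof -
      have "A \<inter> B = A" using that by blast
      then show ?thesis using mr(2) s[OF A] by simp
    qed
    show "factors C u (s (A \<inter> B))" if "u \<in> monos_into C X" "factors C u (s A)" "factors C u (s B)" for u
      using mr(3)[OF s[OF s_sets_Int[OF A B]] that] .
    show "factors C (s (A \<union> B)) u" if "u \<in> monos_into C X" "factors C (s A) u" "factors C (s B) u" for u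
      using jr[OF s[OF s_sets_Un[OF A B]] that] .
  qed
  have "config_of_subobjs C I r X Sub F.quotient_config"
    unfolding config_of_subobjs_def
  proof (intro conjI ballI)
    show "configuration C I r F.quotient_config" by (rule F.quotient_configuration)
    show "\<sigma>\<^bsub>F.quotient_config\<^esub> I = X" by (simp add: F.quotient_config_def F.obj_whole)
    show "\<iota>\<^bsub>F.quotient_config\<^esub> J I \<in> Sub J" if J: "J \<in> s_sets I r" for J
      using F.inj_map_represents[OF J] subobj_equivalent[OF Sub[OF J] s[OF J]]
      by (simp add: F.quotient_config_def)
  qed
  moreover have "comparable_configurations C I r X S T"
    if S: "config_of_subobjs C I r X Sub S" and T: "config_of_subobjs C I r X Sub T"
    for S T :: "('i, 'o, 'm) config"
  proof -
    have conf: "configuration C I r S" "configuration C I r T" "\<sigma>\<^bsub>S\<^esub> I = X" "\<sigma>\<^bsub>T\<^esub> I = X"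
      using S T by (simp_all add: config_of_subobjs_def)
    have same: "factors C (\<iota>\<^bsub>S\<^esub> J I) (\<iota>\<^bsub>T\<^esub> J I)" if J: "J \<in> s_sets I r" for J
    proof -
      have "\<iota>\<^bsub>S\<^esub> J I \<in> Sub J" "\<iota>\<^bsub>T\<^esub> J I \<in> Sub J"
        using S T J by (simp_all add: config_of_subobjs_def)
      then show ?thesis using subobj_equivalent[OF Sub[OF J]] by blast
    qed
    show ?thesis
      by (intro comparable_configurations.intro configuration_pair.intro
          comparable_configurations_axioms.intro configuration_pair_axioms.intro
          abelian_category_axioms preordered_set_axioms conf same)
  qed
  ultimately show ?thesis using ex_unique_isomorphism by blast
qed

end
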